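(* For each integer $n$ with $2\le n\le 7$, the congruence two subgroup $\Gamma^n_2$ of $\Gamma^n=PO_{n,1}\mathbb{Z}$ is a hyperbolic Coxeter group with Coxeter polytope the right-angled polytope $P^n$. That is, $P^n$ is a right-angled hyperbolic polytope, $P^n$ is a fundamental polytope for the action of $\Gamma^n_2$ on $H^n$, and $\Gamma^n_2$ is the group generated by the reflections in the sides of $P^n$.
   Context: Work in $\mathbb{R}^{n+1}$ with the Lorentzian inner product $\langle x,y\rangle=x_1y_1+\dots+x_ny_n-x_{n+1}y_{n+1}$ and the hyperboloid model $H^n=\{x\in\mathbb{R}^{n+1}:\langle x,x\rangle=-1,\ x_{n+1}>0\}$; isometries of $H^n$ are the positive Lorentzian $(n+1)\times(n+1)$ matrices (those preserving $\langle\cdot,\cdot\rangle$ and the sign of the last coordinate on time-like vectors). $\Gamma^n=PO_{n,1}\mathbb{Z}$ denotes the group of positive Lorentzian $(n+1)\times(n+1)$ matrices with integer entries, and $\Gamma^n_2$ is its subgroup of matrices congruent to the identity matrix modulo $2$. A polytope in $H^n$ is a convex polyhedron with finitely many sides and finite volume (equivalently, the convex hull of finitely many actual and ideal vertices); it is right-angled if all dihedral angles between adjacent sides are $0$ or $\pi/2$. Let $\Delta^n$ be the simplex $\Delta^n=\{x\in H^n: x_1\ge x_2\ge\dots\ge x_n\ge 0,\ x_1+x_2+x_3\le x_{n+1}\}$ for $n\ge 3$, and $\Delta^2=\{x\in H^2: x_1\ge x_2\ge 0,\ x_1+x_2\le x_3\}$ (its vertices are represented by $e_1+e_{n+1}$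 (ideal), $e_1+e_2+2e_{n+1}$, $e_1+\dots+e_k+3e_{n+1}$ for $3\le k\le n$, and $e_{n+1}$). For $n\ge3$ let $\Sigma^n$ be the finite group generated by the coordinate transpositions $x_i\leftrightarrow x_{i+1}$ ($1\le i\le n-1$) and the reflection $x\mapsto x-\langle x,w\rangle w$ with $w=e_1+e_2+e_3+e_{n+1}$ (i.e. the reflections in all sides of $\Delta^n$ except the side in $x_n=0$); let $\Sigma^2$ be the group of order $2$ generated by $x_1\leftrightarrow x_2$. Define $P^n=\bigcup_{\gamma\in\Sigma^n}\gamma(\Delta^n)$. *)

theory Defs
  imports Complex_Main
begin

text \<open>Points of R^(n+1) are functions nat => real, coordinates indexed 1..n+1
  (all other coordinates are 0); (n+1)x(n+1) matrices are functions nat => nat => real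
  with entries indexed by {1..n+1} (all other entries 0).\<close>

definition lor :: "nat \<Rightarrow> (nat \<Rightarrow> real) \<Rightarrow> (nat \<Rightarrow> real) \<Rightarrow> real" where
  "lor n x y = (\<Sum>i=1..n. x i * y i) - x (n+1) * y (n+1)"

definition is_vec :: "nat \<Rightarrow> (nat \<Rightarrow> real) \<Rightarrow> bool" where
  "is_vec n x \<longleftrightarrow> (\<forall>i. i \<notin> {1..n+1} \<longrightarrow> x i = 0)"

definition hyp :: "nat \<Rightarrow> (nat \<Rightarrow> real) set" where
  "hyp n = {x. is_vec n x \<and> lor n x x = -1 \<and> x (n+1) > 0}"

definition is_mat :: "nat \<Rightarrow> (nat \<Rightarrow> nat \<Rightarrow> real) \<Rightarrow> bool" where
  "is_mat n A \<longleftrightarrow> (\<forall>i j. (i \<notin> {1..n+1} \<or> j \<notin> {1..n+1}) \<longrightarrow> A i j = 0)"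

definition mat_vec :: "nat \<Rightarrow> (nat \<Rightarrow> nat \<Rightarrow> real) \<Rightarrow> (nat \<Rightarrow> real) \<Rightarrow> (nat \<Rightarrow> real)" where
  "mat_vec n A x = (\<lambda>i. if i \<in> {1..n+1} then (\<Sum>j=1..n+1. A i j * x j) else 0)"

definition mat_mult :: "nat \<Rightarrow> (nat \<Rightarrow> nat \<Rightarrow> real) \<Rightarrow> (nat \<Rightarrow> nat \<Rightarrow> real) \<Rightarrow> (nat \<Rightarrow> nat \<Rightarrow> real)" where
  "mat_mult n A B = (\<lambda>i j. if i \<in> {1..n+1} \<and> j \<in> {1..n+1} then (\<Sum>k=1..n+1. A i k * B k j) else 0)"

definition idm :: "nat \<Rightarrow> nat \<Rightarrow> nat \<Rightarrow> real" where
  "idm n = (\<lambda>i j. if i = j \<and> i \<in> {1..n+1} then 1 else 0)"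

definition lorentzian :: "nat \<Rightarrow> (nat \<Rightarrow> nat \<Rightarrow> real) \<Rightarrow> bool" where
  "lorentzian n A \<longleftrightarrow> is_mat n A \<and>
     (\<forall>x y. is_vec n x \<longrightarrow> is_vec n y \<longrightarrow> lor n (mat_vec n A x) (mat_vec n A y) = lor n x y)"

definition positive_lorentzian :: "nat \<Rightarrow> (nat \<Rightarrow> nat \<Rightarrow> real) \<Rightarrow> bool" where
  "positive_lorentzian n A \<longleftrightarrow> lorentzian n A \<and>
     (\<forall>x. is_vec n x \<longrightarrow> lor n x x < 0 \<longrightarrow> sgn (mat_vec n A x (n+1)) = sgn (x (n+1)))"

definition Gamma :: "nat \<Rightarrow> (nat \<Rightarrow> nat \<Rightarrow> real) set" where
  "Gamma n = {A. positive_lorentzian n A \<and> (\<forall>i j. A i j \<in> \<int>)}"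

definition Gamma2 :: "nat \<Rightarrow> (nat \<Rightarrow> nat \<Rightarrow> real) set" where
  "Gamma2 n = {A \<in> Gamma n. \<forall>i\<in>{1..n+1}. \<forall>j\<in>{1..n+1}.
                  \<exists>k::int. A i j - idm n i j = 2 * of_int k}"

inductive_set gen_grp :: "nat \<Rightarrow> (nat \<Rightarrow> nat \<Rightarrow> real) set \<Rightarrow> (nat \<Rightarrow> nat \<Rightarrow> real) set"
  for n :: nat and S :: "(nat \<Rightarrow> nat \<Rightarrow> real) set" where
  gen_id: "idm n \<in> gen_grp n S"
| gen_gen: "s \<in> S \<Longrightarrow> s \<in> gen_grp n S"
| gen_mult: "a \<in> gen_grp n S \<Longrightarrow> b \<in> gen_grp n S \<Longrightarrow> mat_mult n a b \<in> gen_grp n S"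
| gen_inv: "a \<in> gen_grp n S \<Longrightarrow> is_mat n b \<Longrightarrow> mat_mult n a b = idm n \<Longrightarrow> b \<in> gen_grp n S"

definition act :: "nat \<Rightarrow> (nat \<Rightarrow> nat \<Rightarrow> real) \<Rightarrow> (nat \<Rightarrow> real) set \<Rightarrow> (nat \<Rightarrow> real) set" where
  "act n A S = mat_vec n A ` S"

text \<open>Matrix of the map x |-> x - c <x,w> w.\<close>
definition lin_refl :: "nat \<Rightarrow> real \<Rightarrow> (nat \<Rightarrow> real) \<Rightarrow> (nat \<Rightarrow> nat \<Rightarrow> real)" where
  "lin_refl n c w = (\<lambda>a b. if a \<in> {1..n+1} \<and> b \<in> {1..n+1}
       then idm n a b - c * w a * (if b = n+1 then - w b else w b) else 0)"

definition hrefl :: "nat \<Rightarrow> (nat \<Rightarrow> real) \<Rightarrow> (nat \<Rightarrow> nat \<Rightarrow> real)" where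
  "hrefl n w = lin_refl n (2 / lor n w w) w"

definition swap_mat :: "nat \<Rightarrow> nat \<Rightarrow> (nat \<Rightarrow> nat \<Rightarrow> real)" where
  "swap_mat n i = (\<lambda>a b. if a \<in> {1..n+1} \<and>
       b = (if a = i then i+1 else if a = i+1 then i else a) then 1 else 0)"

definition unit_vec :: "nat \<Rightarrow> nat \<Rightarrow> real" where
  "unit_vec k = (\<lambda>i. if i = k then 1 else 0)"

definition Delta :: "nat \<Rightarrow> (nat \<Rightarrow> real) set" where
  "Delta n = (if n = 2 then {x \<in> hyp 2. x 1 \<ge> x 2 \<and> x 2 \<ge> 0 \<and> x 1 + x 2 \<le> x 3}
     else {x \<in> hyp n. (\<forall>i\<in>{1..<n}. x i \<ge> x (i+1)) \<and> x n \<ge> 0 \<and> x 1 + x 2 + x 3 \<le> x (n+1)})"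

definition Sigma_gens :: "nat \<Rightarrow> (nat \<Rightarrow> nat \<Rightarrow> real) set" where
  "Sigma_gens n = (if n = 2 then {swap_mat 2 1}
     else {swap_mat n i | i. 1 \<le> i \<and> i \<le> n - 1} \<union>
          {lin_refl n 1 (\<lambda>i. unit_vec 1 i + unit_vec 2 i + unit_vec 3 i + unit_vec (n+1) i)})"

definition SigmaG :: "nat \<Rightarrow> (nat \<Rightarrow> nat \<Rightarrow> real) set" where
  "SigmaG n = gen_grp n (Sigma_gens n)"

definition Pn :: "nat \<Rightarrow> (nat \<Rightarrow> real) set" where
  "Pn n = (\<Union>g\<in>SigmaG n. act n g (Delta n))"

text \<open>Topology on H^n via the hyperbolic metric: cosh d(x,y) = - <x,y>.
  h_int n M S: interior of S relative to the ambient set M (a subset of H^n).\<close>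
definition h_int :: "nat \<Rightarrow> (nat \<Rightarrow> real) set \<Rightarrow> (nat \<Rightarrow> real) set \<Rightarrow> (nat \<Rightarrow> real) set" where
  "h_int n M S = {x \<in> S \<inter> M. \<exists>\<epsilon>>0. \<forall>y\<in>M. - lor n x y < 1 + \<epsilon> \<longrightarrow> y \<in> S}"

definition h_closure :: "nat \<Rightarrow> (nat \<Rightarrow> real) set \<Rightarrow> (nat \<Rightarrow> real) set" where
  "h_closure n S = {x \<in> hyp n. \<forall>\<epsilon>>0. \<exists>y\<in>S. - lor n x y < 1 + \<epsilon>}"

text \<open>Polytope: convex hull in H^n of finitely many actual and ideal vertices
  (positive cone spanned by finitely many future-pointing non-space-like vectors, intersected
  with H^n), with nonempty interior.\<close>
definition polytope :: "nat \<Rightarrow> (nat \<Rightarrow> real) set \<Rightarrow> bool" where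
  "polytope n P \<longleftrightarrow>
     (\<exists>V. finite V \<and> V \<subseteq> {v. is_vec n v \<and> lor n v v \<le> 0 \<and> v (n+1) > 0} \<and>
          P = {x \<in> hyp n. \<exists>c. (\<forall>v\<in>V. c v \<ge> 0) \<and> x = (\<lambda>i. \<Sum>v\<in>V. c v * v i)}) \<and>
     h_int n (hyp n) P \<noteq> {}"

definition side_normals :: "nat \<Rightarrow> (nat \<Rightarrow> real) set \<Rightarrow> (nat \<Rightarrow> real) set" where
  "side_normals n P = {e. is_vec n e \<and> lor n e e = 1 \<and> (\<forall>x\<in>P. lor n x e \<le> 0) \<and>
      h_int n (hyp n \<inter> {y. lor n y e = 0}) (P \<inter> {y. lor n y e = 0}) \<noteq> {}}"

text \<open>Sides with normals e, f are adjacent if they meet in a ridge (a set with nonempty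
  interior in the codimension-two plane e^perp \<inter> f^perp \<inter> H^n).  The dihedral angle theta between
  adjacent sides satisfies cos theta = - <e,f>.\<close>
definition adjacent_sides :: "nat \<Rightarrow> (nat \<Rightarrow> real) set \<Rightarrow> (nat \<Rightarrow> real) \<Rightarrow> (nat \<Rightarrow> real) \<Rightarrow> bool" where
  "adjacent_sides n P e f \<longleftrightarrow> e \<noteq> f \<and>
     h_int n (hyp n \<inter> {y. lor n y e = 0} \<inter> {y. lor n y f = 0})
             (P \<inter> {y. lor n y e = 0} \<inter> {y. lor n y f = 0}) \<noteq> {}"

definition right_angled_polytope :: "nat \<Rightarrow> (nat \<Rightarrow> real) set \<Rightarrow> bool" where
  "right_angled_polytope n P \<longleftrightarrow> polytope n P \<and>
     (\<forall>e\<in>side_normals n P. \<forall>f\<in>side_normals n P. adjacent_sides n P e f \<longrightarrow>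
        arccos (- lor n e f) = 0 \<or> arccos (- lor n e f) = pi / 2)"

text \<open>Fundamental polytope (Ratcliffe): P is a polytope whose interior is a locally finite
  fundamental domain for the group G acting on H^n.\<close>
definition fundamental_polytope :: "nat \<Rightarrow> (nat \<Rightarrow> nat \<Rightarrow> real) set \<Rightarrow> (nat \<Rightarrow> real) set \<Rightarrow> bool" where
  "fundamental_polytope n G P \<longleftrightarrow> polytope n P \<and>
     (\<forall>g\<in>G. \<forall>h\<in>G. g \<noteq> h \<longrightarrow>
        act n g (h_int n (hyp n) P) \<inter> act n h (h_int n (hyp n) P) = {}) \<and>
     hyp n = (\<Union>g\<in>G. act n g (h_closure n (h_int n (hyp n) P))) \<and>
     (\<forall>x\<in>hyp n. \<exists>\<epsilon>>0. finite {g\<in>G. \<exists>y\<in>act n g (h_closure n (h_int n (hyp n) P)).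
                                       - lor n x y < 1 + \<epsilon>})"

definition side_reflections :: "nat \<Rightarrow> (nat \<Rightarrow> real) set \<Rightarrow> (nat \<Rightarrow> nat \<Rightarrow> real) set" where
  "side_reflections n P = hrefl n ` side_normals n P"

end

theory Submission
  imports Defs "HOL-Library.Function_Algebras" "HOL-Library.Real_Mod" "HOL-Analysis.L2_Norm"
    "Jordan_Normal_Form.Determinant"
begin

text \<open>Let \<open>\<kappa> = e\<^sub>1 + \<dots> + e\<^sub>n + 3 e\<^sub>n\<^sub>+\<^sub>1\<close>, which is time-like with norm \<open>n - 9\<close> and characteristic:
  \<open>\<langle>u, u\<rangle> \<equiv> \<langle>u, \<kappa>\<rangle> mod 2\<close> for integral \<open>u\<close>.  Call an integral \<open>e\<close> with \<open>\<langle>e, e\<rangle> = 1\<close> and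
  \<open>\<langle>e, \<kappa>\<rangle> = -1\<close> exceptional (these are the classes of the lines on a del Pezzo surface).  The group
  \<open>\<Sigma>\<^sup>n\<close> fixes \<open>\<kappa>\<close>, hence permutes the exceptional vectors, and \<open>P\<^sup>n\<close> turns out to be the set of
  all \<open>x\<close> with \<open>\<langle>x, e\<rangle> \<le> 0\<close> for all of them; they are therefore the side normals.

  Every integral unit vector \<open>r\<close> with \<open>\<langle>r, \<kappa>\<rangle> < 0\<close> is nonpositive on \<open>P\<^sup>n\<close>: it is space-like, so it
  meets some exceptional \<open>e\<close> positively, and unless \<open>\<langle>r, \<kappa>\<rangle> = -1\<close> reflecting in \<open>e\<close> decreases
  \<open>-\<langle>r, \<kappa>\<rangle>\<close> without making it negative (Cauchy-Schwarz in the complement of \<open>\<kappa>\<close>).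
  Consequently an element of \<open>\<Gamma>\<^sup>n\<close> that maps an interior point of \<open>P\<^sup>n\<close> to an interior point
  permutes the exceptional vectors; they are pairwise incongruent modulo 2 (this needs \<open>n \<le> 7\<close>), so
  if it lies in \<open>\<Gamma>\<^sup>n\<^sub>2\<close> it is the identity.  Covering, generation by the reflections and local
  finiteness all follow by descent along the discrete orbit of \<open>\<kappa>\<close>.\<close>

hide_const (open) Matrix.unit_vec
hide_fact (open) Matrix.unit_vec_def

section \<open>Functions as vectors, and integers among the reals\<close>

instantiation "fun" :: (type, real_vector) real_vector
begin

definition scaleR_fun :: "real \<Rightarrow> ('a \<Rightarrow> 'b) \<Rightarrow> 'a \<Rightarrow> 'b" where
  "scaleR_fun r f = (\<lambda>x. r *\<^sub>R f x)"

instance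
  by standard (simp_all add: scaleR_fun_def fun_eq_iff scaleR_add_left scaleR_add_right)

end

lemma scaleR_fun_apply [simp]: "(r *\<^sub>R f) x = r *\<^sub>R f x"
  by (simp add: scaleR_fun_def)

lemma sum_fun_apply: "(\<Sum>k\<in>K. f k) x = (\<Sum>k\<in>K. f k x)"
  by (induction K rule: infinite_finite_induct) simp_all

lemma conic_combination_regroup:
  fixes w :: "'k \<Rightarrow> 'a::real_vector" and a :: "'k \<Rightarrow> real"
  assumes V: "finite V" "w ` K \<subseteq> V" and K: "finite K" and a: "\<And>k. k \<in> K \<Longrightarrow> 0 \<le> a k"
  shows "\<exists>c. (\<forall>v\<in>V. 0 \<le> c v) \<and> (\<Sum>k\<in>K. a k *\<^sub>R w k) = (\<Sum>v\<in>V. c v *\<^sub>R v)"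
proof -
  define c where "c v = (\<Sum>k\<in>{k\<in>K. w k = v}. a k)" for v
  have "(\<Sum>v\<in>V. c v *\<^sub>R v) = (\<Sum>v\<in>V. \<Sum>k\<in>{k\<in>K. w k = v}. a k *\<^sub>R w k)"
    unfolding c_def scaleR_sum_left by (intro sum.cong) auto
  also have "\<dots> = (\<Sum>k\<in>K. a k *\<^sub>R w k)" using V K by (intro sum.group) auto
  moreover have "0 \<le> c v" for v unfolding c_def using a by (intro sum_nonneg) auto
  ultimately show ?thesis by metis
qed

lemma Ints_less_imp_add1_le:
  fixes a b :: "'a::linordered_idom" assumes "a \<in> \<int>" "b \<in> \<int>" "a < b" shows "a + 1 \<le> b"
  using assms Ints_nonzero_abs_ge1[of "b - a"] by simp

lemma rcong_2_iff: "[a = b] (rmod 2) \<longleftrightarrow> (a - b) / 2 \<in> \<int>"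
proof
  assume "[a = b] (rmod 2)"
  then obtain k where "b = a + of_int k * 2" by (auto simp: rcong_altdef)
  thus "(a - b) / 2 \<in> \<int>" by simp
next
  assume "(a - b) / 2 \<in> \<int>"
  then obtain k where "(a - b) / 2 = of_int k" by (rule Ints_cases)
  hence "b = a + of_int (- k) * 2" by simp
  thus "[a = b] (rmod 2)" unfolding rcong_altdef by blast
qed

lemma rcong_2_iff_ex_int: "[a = b] (rmod 2) \<longleftrightarrow> (\<exists>k::int. a - b = 2 * of_int k)"
  unfolding rcong_2_iff by (auto simp: Ints_def field_simps)

lemma rcong_2_square:
  assumes "x \<in> \<int>" shows "[x * x = x] (rmod 2)"
proof -
  obtain k where k: "x = of_int k" using assms by (rule Ints_cases)
  have "even (k * k - k)" by simp
  then obtain m where "k * k - k = 2 * m" by (rule dvdE)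
  hence "x * x - x = 2 * of_int m" unfolding k by (metis of_int_diff of_int_mult of_int_numeral)
  thus ?thesis by (simp add: rcong_2_iff)
qed

lemma rcong_sum:
  "(\<And>i. i \<in> I \<Longrightarrow> [f i = g i] (rmod m)) \<Longrightarrow> [\<Sum>i\<in>I. f i = \<Sum>i\<in>I. g i] (rmod m)"
  by (induction I rule: infinite_finite_induct) (auto intro: rcong_add)

lemma rcong_1_imp_neq_0:
  assumes "[x = 1] (rmod 2)" shows "x \<noteq> 0"
  using assms Ints_nonzero_abs_ge1[of "- 1 / 2"] by (auto simp: rcong_2_iff)

lemma rcong_1_negative_cases:
  assumes "[x = 1] (rmod 2)" "x < 0" shows "x = -1 \<or> x \<le> -3"
proof -
  define y where "y = (x - 1) / 2"
  have x: "x = 2 * y + 1" by (simp add: y_def field_simps)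
  have y: "y \<in> \<int>" using assms(1) by (simp add: rcong_2_iff y_def)
  have "y + 1 \<le> 0" using assms(2) x by (intro Ints_less_imp_add1_le y) auto
  moreover have "y + 1 \<le> -1" if "y < -1" using that by (intro Ints_less_imp_add1_le y) auto
  ultimately show ?thesis unfolding x by linarith
qed

lemma Ints_abs_le_square:
  fixes x :: "'a::linordered_idom" assumes "x \<in> \<int>" shows "\<bar>x\<bar> \<le> x * x"
proof (cases "x = 0")
  case False
  hence "\<bar>x\<bar> * 1 \<le> \<bar>x\<bar> * \<bar>x\<bar>" using assms by (intro mult_left_mono Ints_nonzero_abs_ge1) auto
  thus ?thesis by simp
qed simp

section \<open>The Lorentzian form\<close>

locale lorentzian_space =
  fixes n :: nat
begin

abbreviation form :: "(nat \<Rightarrow> real) \<Rightarrow> (nat \<Rightarrow> real) \<Rightarrow> real" (\<open>\<langle>_, _\<rangle>\<close>) where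
  "\<langle>x, y\<rangle> \<equiv> lor n x y"

abbreviation spatial_norm :: "(nat \<Rightarrow> real) \<Rightarrow> real" where
  "spatial_norm x \<equiv> L2_set x {1..n}"

lemma lor_commute: "\<langle>x, y\<rangle> = \<langle>y, x\<rangle>"
  by (simp add: lor_def mult.commute)

lemma linear_lor_left: "linear (\<lambda>x. \<langle>x, z\<rangle>)"
  by (rule linearI) (simp_all add: lor_def sum.distrib sum_distrib_left algebra_simps)

lemma lor_add_left [simp]: "\<langle>x + y, z\<rangle> = \<langle>x, z\<rangle> + \<langle>y, z\<rangle>"
  and lor_diff_left [simp]: "\<langle>x - y, z\<rangle> = \<langle>x, z\<rangle> - \<langle>y, z\<rangle>"
  and lor_minus_left [simp]: "\<langle>- x, z\<rangle> = - \<langle>x, z\<rangle>"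
  and lor_scaleR_left [simp]: "\<langle>r *\<^sub>R x, z\<rangle> = r * \<langle>x, z\<rangle>"
  and lor_zero_left [simp]: "\<langle>0, z\<rangle> = 0"
  and lor_sum_left: "\<langle>\<Sum>k\<in>K. f k, z\<rangle> = (\<Sum>k\<in>K. \<langle>f k, z\<rangle>)"
  by (fact linear_add[OF linear_lor_left] linear_diff[OF linear_lor_left]
      linear_neg[OF linear_lor_left] linear_scale[OF linear_lor_left, unfolded real_scaleR_def] linear_0[OF linear_lor_left]
      linear_sum[OF linear_lor_left])+

lemma lor_add_right [simp]: "\<langle>z, x + y\<rangle> = \<langle>z, x\<rangle> + \<langle>z, y\<rangle>"
  and lor_diff_right [simp]: "\<langle>z, x - y\<rangle> = \<langle>z, x\<rangle> - \<langle>z, y\<rangle>"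
  and lor_minus_right [simp]: "\<langle>z, - x\<rangle> = - \<langle>z, x\<rangle>"
  and lor_scaleR_right [simp]: "\<langle>z, r *\<^sub>R x\<rangle> = r * \<langle>z, x\<rangle>"
  and lor_zero_right [simp]: "\<langle>z, 0\<rangle> = 0"
  by (simp_all add: lor_commute[of z])

lemma is_vec_add [simp]: "is_vec n x \<Longrightarrow> is_vec n y \<Longrightarrow> is_vec n (x + y)"
  and is_vec_diff [simp]: "is_vec n x \<Longrightarrow> is_vec n y \<Longrightarrow> is_vec n (x - y)"
  and is_vec_minus [simp]: "is_vec n x \<Longrightarrow> is_vec n (- x)"
  and is_vec_scaleR [simp]: "is_vec n x \<Longrightarrow> is_vec n (r *\<^sub>R x)"
  by (simp_all add: is_vec_def)

lemma is_vec_eqI: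
  assumes "is_vec n x" "is_vec n y" "\<And>i. i \<in> {1..n} \<Longrightarrow> x i = y i" "x (n+1) = y (n+1)"
  shows "x = y"
proof
  fix i
  consider "i \<in> {1..n}" | "i = n+1" | "i \<notin> {1..n+1}" by fastforce
  thus "x i = y i" using assms by cases (auto simp: is_vec_def)
qed

lemma lor_self: "\<langle>x, x\<rangle> = (spatial_norm x)\<^sup>2 - (x (n+1))\<^sup>2"
  by (simp add: lor_def L2_set_def sum_nonneg power2_eq_square)

lemma timelike_iff: "\<langle>x, x\<rangle> < 0 \<longleftrightarrow> spatial_norm x < \<bar>x (n+1)\<bar>"
  and nonspacelike_iff: "\<langle>x, x\<rangle> \<le> 0 \<longleftrightarrow> spatial_norm x \<le> \<bar>x (n+1)\<bar>"
  using abs_le_square_iff[of "x (n+1)" "spatial_norm x"]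
    abs_le_square_iff[of "spatial_norm x" "x (n+1)"]
  by (auto simp: lor_self)

lemma spatial_product_le: "\<bar>\<Sum>i=1..n. x i * y i\<bar> \<le> spatial_norm x * spatial_norm y"
  using sum_abs[of "\<lambda>i. x i * y i" "{1..n}"] L2_set_mult_ineq[of x y "{1..n}"]
  by (simp add: abs_mult)

lemma is_vec_eq_0I:
  assumes "is_vec n x" "spatial_norm x = 0" "x (n+1) = 0"
  shows "x = 0"
  using assms by (intro is_vec_eqI) (auto simp: L2_set_eq_0_iff is_vec_def)

lemma lor_causal_future_nonpos:
  assumes "\<langle>x, x\<rangle> \<le> 0" "\<langle>y, y\<rangle> \<le> 0" "x (n+1) \<ge> 0" "y (n+1) \<ge> 0"
  shows "\<langle>x, y\<rangle> \<le> 0"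
proof -
  have "(\<Sum>i=1..n. x i * y i) \<le> spatial_norm x * spatial_norm y"
    using spatial_product_le[of x y] by linarith
  also have "\<dots> \<le> x (n+1) * y (n+1)"
    using assms by (intro mult_mono) (auto simp: nonspacelike_iff)
  finally show ?thesis by (simp add: lor_def)
qed

lemma timelike_causal_sign_iff:
  assumes v: "\<langle>v, v\<rangle> < 0" "v (n+1) > 0" and x: "\<langle>x, x\<rangle> \<le> 0"
  shows "\<langle>x, v\<rangle> < 0 \<longleftrightarrow> x (n+1) > 0"
proof
  assume pos: "x (n+1) > 0"
  have "(\<Sum>i=1..n. x i * v i) \<le> spatial_norm x * spatial_norm v"
    using spatial_product_le[of x v] by linarith
  also have "\<dots> \<le> x (n+1) * spatial_norm v"
    using x pos by (intro mult_right_mono) (auto simp: nonspacelike_iff)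
  also have "\<dots> < x (n+1) * v (n+1)"
    using v pos by (intro mult_strict_left_mono) (auto simp: timelike_iff)
  finally show "\<langle>x, v\<rangle> < 0" by (simp add: lor_def)
next
  assume neg: "\<langle>x, v\<rangle> < 0"
  show "x (n+1) > 0"
  proof (rule ccontr)
    assume "\<not> x (n+1) > 0"
    hence "\<langle>- x, v\<rangle> \<le> 0" using x v lor_causal_future_nonpos[of "- x" v] by simp
    thus False using neg by simp
  qed
qed

lemma timelike_orthogonal_pos:
  assumes v: "\<langle>v, v\<rangle> < 0" and a: "\<langle>a, v\<rangle> = 0" "is_vec n a" "a \<noteq> 0"
  shows "\<langle>a, a\<rangle> > 0"
proof (rule ccontr)
  assume "\<not> \<langle>a, a\<rangle> > 0"
  hence le: "spatial_norm a \<le> \<bar>a (n+1)\<bar>" unfolding not_less nonspacelike_iff .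
  have "a (n+1) \<noteq> 0"
  proof
    assume 0: "a (n+1) = 0"
    hence "spatial_norm a = 0" using le L2_set_nonneg[of a "{1..n}"] by linarith
    thus False using a(2,3) 0 is_vec_eq_0I by blast
  qed
  hence "\<bar>a (n+1)\<bar> * spatial_norm v < \<bar>a (n+1)\<bar> * \<bar>v (n+1)\<bar>"
    using v by (intro mult_strict_left_mono) (auto simp: timelike_iff)
  also have "\<dots> = \<bar>\<Sum>i=1..n. a i * v i\<bar>" using a(1) by (simp add: lor_def abs_mult)
  also have "\<dots> \<le> spatial_norm a * spatial_norm v" by (rule spatial_product_le)
  also have "\<dots> \<le> \<bar>a (n+1)\<bar> * spatial_norm v" using le by (intro mult_right_mono) auto
  finally show False by simp
qed

lemma timelike_orthogonal_nonneg:
  assumes "\<langle>v, v\<rangle> < 0" "\<langle>a, v\<rangle> = 0" "is_vec n a"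
  shows "\<langle>a, a\<rangle> \<ge> 0"
  using timelike_orthogonal_pos[OF assms] by (cases "a = 0") auto

lemma lor_reverse_Cauchy_Schwarz:
  assumes v: "\<langle>v, v\<rangle> < 0" "is_vec n v" and a: "is_vec n a"
  shows "\<langle>a, a\<rangle> * \<langle>v, v\<rangle> \<le> \<langle>a, v\<rangle>\<^sup>2"
proof -
  let ?a = "\<langle>v, v\<rangle> *\<^sub>R a - \<langle>a, v\<rangle> *\<^sub>R v"
  have "0 \<le> \<langle>?a, ?a\<rangle>" using assms by (intro timelike_orthogonal_nonneg[OF v(1)]) auto
  also have "\<dots> = \<langle>v, v\<rangle> * (\<langle>a, a\<rangle> * \<langle>v, v\<rangle> - \<langle>a, v\<rangle>\<^sup>2)"
    by (simp add: lor_commute[of v a] algebra_simps power2_eq_square)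
  finally show ?thesis using v(1) by (simp add: zero_le_mult_iff)
qed

lemma lor_Cauchy_Schwarz_orthogonal:
  assumes v: "\<langle>v, v\<rangle> < 0" and a: "\<langle>a, v\<rangle> = 0" "is_vec n a" and b: "\<langle>b, v\<rangle> = 0" "is_vec n b"
  shows "\<langle>a, b\<rangle>\<^sup>2 \<le> \<langle>a, a\<rangle> * \<langle>b, b\<rangle>"
proof (cases "b = 0")
  case False
  let ?c = "\<langle>b, b\<rangle> *\<^sub>R a - \<langle>a, b\<rangle> *\<^sub>R b"
  have pos: "\<langle>b, b\<rangle> > 0" using v b False by (rule timelike_orthogonal_pos)
  have "0 \<le> \<langle>?c, ?c\<rangle>" using a b by (intro timelike_orthogonal_nonneg[OF v]) auto
  also have "\<langle>?c, ?c\<rangle> = \<langle>b, b\<rangle> * (\<langle>a, a\<rangle> * \<langle>b, b\<rangle> - \<langle>a, b\<rangle>\<^sup>2)"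
    by (simp add: lor_commute[of b a] algebra_simps power2_eq_square)
  finally show ?thesis using pos by (simp add: zero_le_mult_iff)
qed simp

text \<open>The orthogonal projections along \<open>v\<close> are scaled by \<open>\<langle>v, v\<rangle>\<close> to avoid division.\<close>
lemma lor_Cauchy_Schwarz_projected:
  assumes v: "\<langle>v, v\<rangle> < 0" "is_vec n v" and a: "is_vec n a" and b: "is_vec n b"
  shows "(\<langle>a, b\<rangle> * \<langle>v, v\<rangle> - \<langle>a, v\<rangle> * \<langle>b, v\<rangle>)\<^sup>2
       \<le> (\<langle>a, a\<rangle> * \<langle>v, v\<rangle> - \<langle>a, v\<rangle>\<^sup>2) * (\<langle>b, b\<rangle> * \<langle>v, v\<rangle> - \<langle>b, v\<rangle>\<^sup>2)"
proof -
  define p where "p x = \<langle>v, v\<rangle> *\<^sub>R x - \<langle>x, v\<rangle> *\<^sub>R v" for x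
  have lor_p: "\<langle>p x, p y\<rangle> = \<langle>v, v\<rangle> * (\<langle>x, y\<rangle> * \<langle>v, v\<rangle> - \<langle>x, v\<rangle> * \<langle>y, v\<rangle>)" for x y
    by (simp add: p_def lor_commute[of v x] lor_commute[of v y] algebra_simps)
  have "\<langle>p a, p b\<rangle>\<^sup>2 \<le> \<langle>p a, p a\<rangle> * \<langle>p b, p b\<rangle>"
    using v a b by (intro lor_Cauchy_Schwarz_orthogonal[OF v(1)]) (auto simp: p_def)
  hence "\<langle>v, v\<rangle>\<^sup>2 * (\<langle>a, b\<rangle> * \<langle>v, v\<rangle> - \<langle>a, v\<rangle> * \<langle>b, v\<rangle>)\<^sup>2
      \<le> \<langle>v, v\<rangle>\<^sup>2 * ((\<langle>a, a\<rangle> * \<langle>v, v\<rangle> - \<langle>a, v\<rangle>\<^sup>2) * (\<langle>b, b\<rangle> * \<langle>v, v\<rangle> - \<langle>b, v\<rangle>\<^sup>2))"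
    unfolding lor_p by (simp add: power_mult_distrib power2_eq_square mult_ac)
  thus ?thesis using v(1) by (simp add: mult_le_cancel_left)
qed

section \<open>Hyperbolic space\<close>

lemma hypD:
  assumes "x \<in> hyp n" shows "is_vec n x" "\<langle>x, x\<rangle> = -1" "x (n+1) > 0"
  using assms by (simp_all add: hyp_def)

lemma hyp_timelike: "x \<in> hyp n \<Longrightarrow> \<langle>x, x\<rangle> < 0"
  by (simp add: hyp_def)

lemma hyp_scaled_timelike:
  assumes "is_vec n z" "\<langle>z, z\<rangle> < 0" "z (n+1) > 0"
  shows "(1 / sqrt (- \<langle>z, z\<rangle>)) *\<^sub>R z \<in> hyp n"
  using assms by (simp add: hyp_def real_div_sqrt)

lemma timelike_future_scales_into_hyp:
  assumes "is_vec n z" "\<langle>z, z\<rangle> < 0" "z (n+1) > 0"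
  obtains r where "r > 0" "r *\<^sub>R z \<in> hyp n"
  using that[OF _ hyp_scaled_timelike[OF assms]] assms(2) by simp

lemma hyp_minus_lor_ge_1:
  assumes "x \<in> hyp n" "y \<in> hyp n" shows "1 \<le> - \<langle>x, y\<rangle>"
proof -
  note X = hypD[OF assms(1)] and Y = hypD[OF assms(2)]
  have "1\<^sup>2 \<le> (- \<langle>x, y\<rangle>)\<^sup>2"
    using lor_reverse_Cauchy_Schwarz[of y x] X Y by simp
  moreover have "\<langle>x, y\<rangle> \<le> 0" using X Y lor_causal_future_nonpos[of x y] by simp
  ultimately show ?thesis using power2_le_imp_le[of 1 "- \<langle>x, y\<rangle>"] by simp
qed

lemma hyp_Cauchy_Schwarz:
  assumes x: "x \<in> hyp n" and "is_vec n a" "is_vec n b"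
  shows "(\<langle>a, b\<rangle> + \<langle>a, x\<rangle> * \<langle>b, x\<rangle>)\<^sup>2 \<le> (\<langle>a, a\<rangle> + \<langle>a, x\<rangle>\<^sup>2) * (\<langle>b, b\<rangle> + \<langle>b, x\<rangle>\<^sup>2)"
  using lor_Cauchy_Schwarz_projected[of x a b] hypD[OF x] assms(2,3)
  by (simp add: power2_eq_square algebra_simps)

lemma hyp_projection_nonneg:
  assumes "x \<in> hyp n" "is_vec n a" shows "0 \<le> \<langle>a, a\<rangle> + \<langle>a, x\<rangle>\<^sup>2"
  using lor_reverse_Cauchy_Schwarz[of x a] hypD[OF assms(1)] assms(2) by simp

lemma nonspacelike_lor_le:
  assumes x: "x \<in> hyp n" and a: "is_vec n a" "\<langle>a, a\<rangle> \<le> 0" and b: "is_vec n b" "\<langle>b, b\<rangle> \<le> 0"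
  shows "\<bar>\<langle>a, b\<rangle>\<bar> \<le> 2 * \<bar>\<langle>a, x\<rangle>\<bar> * \<bar>\<langle>b, x\<rangle>\<bar>"
proof -
  have "(\<langle>a, b\<rangle> + \<langle>a, x\<rangle> * \<langle>b, x\<rangle>)\<^sup>2 \<le> (\<langle>a, a\<rangle> + \<langle>a, x\<rangle>\<^sup>2) * (\<langle>b, b\<rangle> + \<langle>b, x\<rangle>\<^sup>2)"
    using x a(1) b(1) by (rule hyp_Cauchy_Schwarz)
  also have "\<dots> \<le> \<langle>a, x\<rangle>\<^sup>2 * \<langle>b, x\<rangle>\<^sup>2"
    using a b hyp_projection_nonneg[OF x] by (intro mult_mono) auto
  finally have "\<bar>\<langle>a, b\<rangle> + \<langle>a, x\<rangle> * \<langle>b, x\<rangle>\<bar> \<le> \<bar>\<langle>a, x\<rangle> * \<langle>b, x\<rangle>\<bar>"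
    by (simp add: abs_le_square_iff power_mult_distrib)
  thus ?thesis unfolding mult.assoc abs_mult[symmetric] by linarith
qed

lemma meeting_walls_lor_less_1:
  assumes x: "\<langle>x, x\<rangle> < 0" "\<langle>e, x\<rangle> = 0" "\<langle>f, x\<rangle> = 0"
    and e: "is_vec n e" "\<langle>e, e\<rangle> = 1" and f: "is_vec n f" "\<langle>f, f\<rangle> = 1" and ne: "e \<noteq> f" "e \<noteq> - f"
  shows "\<bar>\<langle>e, f\<rangle>\<bar> < 1"
proof -
  have "e - f \<noteq> 0" "e + f \<noteq> 0" using ne eq_neg_iff_add_eq_0[of e f] by auto
  hence "\<langle>e - f, e - f\<rangle> > 0" "\<langle>e + f, e + f\<rangle> > 0"
    using x e f by (intro timelike_orthogonal_pos[OF x(1)]; simp)+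
  thus ?thesis using e f by (simp add: lor_commute[of f e])
qed

lemma hyp_perturb:
  assumes x: "x \<in> hyp n" and u: "is_vec n u" and \<epsilon>: "\<epsilon> > 0"
  obtains r s where "r > 0" "s > 0" "r *\<^sub>R (x + s *\<^sub>R u) \<in> hyp n"
    "- \<langle>x, r *\<^sub>R (x + s *\<^sub>R u)\<rangle> < 1 + \<epsilon>"
proof -
  note X = hypD[OF x]
  define q where "q s = - \<langle>x + s *\<^sub>R u, x + s *\<^sub>R u\<rangle>" for s
  have q_eq: "q s = 1 - s * (2 * \<langle>x, u\<rangle>) - s * s * \<langle>u, u\<rangle>" for s
    by (simp add: q_def X lor_commute[of u x] algebra_simps)
  have q_lim: "(q \<longlongrightarrow> 1) (at_right 0)"
    unfolding q_eq[abs_def] by (auto intro!: tendsto_eq_intros)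
  have "((\<lambda>s. (x + s *\<^sub>R u) (n+1)) \<longlongrightarrow> x (n+1)) (at_right 0)"
    by (auto intro!: tendsto_eq_intros)
  hence future: "\<forall>\<^sub>F s in at_right 0. 0 < (x + s *\<^sub>R u) (n+1)"
    using X(3) by (rule order_tendstoD(1))
  have "((\<lambda>s. 1 / sqrt (q s) * (1 - s * \<langle>x, u\<rangle>)) \<longlongrightarrow> 1) (at_right 0)"
    using q_lim by (auto intro!: tendsto_eq_intros)
  hence near: "\<forall>\<^sub>F s in at_right 0. 1 / sqrt (q s) * (1 - s * \<langle>x, u\<rangle>) < 1 + \<epsilon>"
    using \<epsilon> by (intro order_tendstoD(2)) auto
  have "\<forall>\<^sub>F s in at_right 0. 0 < q s"
    using q_lim by (rule order_tendstoD(1)) simp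
  with future near have "\<forall>\<^sub>F s in at_right 0. 0 < s \<and> 0 < q s \<and> 0 < (x + s *\<^sub>R u) (n+1) \<and>
      1 / sqrt (q s) * (1 - s * \<langle>x, u\<rangle>) < 1 + \<epsilon>"
    using eventually_at_right_less[of 0] by eventually_elim blast
  then obtain s where s: "0 < s" "0 < q s" "0 < (x + s *\<^sub>R u) (n+1)"
      "1 / sqrt (q s) * (1 - s * \<langle>x, u\<rangle>) < 1 + \<epsilon>"
    using eventually_happens'[OF trivial_limit_at_right_real] by blast
  show thesis
  proof
    show "0 < 1 / sqrt (q s)" using s(2) by simp
    show "(1 / sqrt (q s)) *\<^sub>R (x + s *\<^sub>R u) \<in> hyp n"
      unfolding q_def using s(2,3) X u by (intro hyp_scaled_timelike) (auto simp: q_def)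
    show "- \<langle>x, (1 / sqrt (q s)) *\<^sub>R (x + s *\<^sub>R u)\<rangle> < 1 + \<epsilon>"
      using s(4) X(2) by (simp add: algebra_simps)
  qed (rule s(1))
qed

text \<open>With \<open>c = - \<langle>x, y\<rangle>\<close>, Cauchy-Schwarz bounds the squared deviation of \<open>\<langle>y, e\<rangle>\<close>
  from \<open>c * \<langle>x, e\<rangle>\<close> by a multiple of \<open>c\<^sup>2 - 1\<close>; this dictates the choice of the radius.\<close>
lemma eventually_hyp_near_negative:
  assumes x: "x \<in> hyp n" and e: "is_vec n e" and neg: "\<langle>x, e\<rangle> < 0"
  shows "\<forall>\<^sub>F \<epsilon> in at_right 0. \<forall>y\<in>hyp n. - \<langle>x, y\<rangle> < 1 + \<epsilon> \<longrightarrow> \<langle>y, e\<rangle> < 0"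
proof -
  define K where "K = \<langle>e, e\<rangle> + \<langle>e, x\<rangle>\<^sup>2"
  define R where "R = sqrt (1 + \<langle>e, x\<rangle>\<^sup>2 / (K + 1))"
  have K: "0 \<le> K" unfolding K_def using x e by (rule hyp_projection_nonneg)
  have ex: "\<langle>e, x\<rangle> < 0" using neg by (simp add: lor_commute)
  have "0 < \<langle>e, x\<rangle>\<^sup>2 / (K + 1)" using K ex by (intro divide_pos_pos) auto
  hence R: "1 < R" by (simp add: R_def)
  have "\<langle>y, e\<rangle> < 0" if y: "y \<in> hyp n" and near: "- \<langle>x, y\<rangle> < R" for y
  proof (rule ccontr)
    assume "\<not> \<langle>y, e\<rangle> < 0"
    note Y = hypD[OF y]
    have yx: "1 \<le> - \<langle>y, x\<rangle>" "- \<langle>y, x\<rangle> < R"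
      using hyp_minus_lor_ge_1[OF y x] near by (simp_all add: lor_commute)
    hence "(- \<langle>y, x\<rangle>)\<^sup>2 < R\<^sup>2" by (intro power_strict_mono) auto
    also have "R\<^sup>2 = 1 + \<langle>e, x\<rangle>\<^sup>2 / (K + 1)" using K by (simp add: R_def)
    finally have c: "(\<langle>y, x\<rangle>\<^sup>2 - 1) * (K + 1) < \<langle>e, x\<rangle>\<^sup>2"
      using K by (simp add: field_simps)
    have "1 * - \<langle>e, x\<rangle> \<le> - \<langle>y, x\<rangle> * - \<langle>e, x\<rangle>"
      using yx(1) ex by (intro mult_right_mono) auto
    hence "- \<langle>e, x\<rangle> \<le> \<langle>y, e\<rangle> + \<langle>y, x\<rangle> * \<langle>e, x\<rangle>" using \<open>\<not> \<langle>y, e\<rangle> < 0\<close> by simp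
    hence "(- \<langle>e, x\<rangle>)\<^sup>2 \<le> (\<langle>y, e\<rangle> + \<langle>y, x\<rangle> * \<langle>e, x\<rangle>)\<^sup>2"
      using ex by (intro power_mono) auto
    also have "\<dots> \<le> (\<langle>y, x\<rangle>\<^sup>2 - 1) * K"
      using hyp_Cauchy_Schwarz[OF x Y(1) e] by (simp add: K_def Y(2))
    also have "\<dots> \<le> (\<langle>y, x\<rangle>\<^sup>2 - 1) * (K + 1)"
      using power_mono[OF yx(1), of 2] by (intro mult_left_mono) auto
    finally show False using c by simp
  qed
  thus ?thesis using R by (intro eventually_at_rightI[of 0 "R - 1"]) auto
qed

section \<open>Polyhedra cut out by walls\<close>

definition polar_cone :: "(nat \<Rightarrow> real) set \<Rightarrow> (nat \<Rightarrow> real) set" where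
  "polar_cone N = {x. is_vec n x \<and> (\<forall>e\<in>N. \<langle>x, e\<rangle> \<le> 0)}"

definition open_polar_cone :: "(nat \<Rightarrow> real) set \<Rightarrow> (nat \<Rightarrow> real) set" where
  "open_polar_cone N = {x. is_vec n x \<and> (\<forall>e\<in>N. \<langle>x, e\<rangle> < 0)}"

lemma polar_coneD: "x \<in> polar_cone N \<Longrightarrow> e \<in> N \<Longrightarrow> \<langle>x, e\<rangle> \<le> 0"
  and open_polar_coneD: "x \<in> open_polar_cone N \<Longrightarrow> e \<in> N \<Longrightarrow> \<langle>x, e\<rangle> < 0"
  by (simp_all add: polar_cone_def open_polar_cone_def)

lemma open_polar_cone_subset: "open_polar_cone N \<subseteq> polar_cone N"
  by (force simp: polar_cone_def open_polar_cone_def)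

lemma hyp_near_open_polar_cone:
  assumes N: "finite N" "\<And>e. e \<in> N \<Longrightarrow> is_vec n e" and x: "x \<in> hyp n \<inter> open_polar_cone N"
  obtains \<epsilon> where "\<epsilon> > 0" "\<And>y. y \<in> hyp n \<Longrightarrow> - \<langle>x, y\<rangle> < 1 + \<epsilon> \<Longrightarrow> y \<in> open_polar_cone N"
proof -
  have "\<forall>\<^sub>F \<epsilon> in at_right 0. \<forall>e\<in>N. \<forall>y\<in>hyp n. - \<langle>x, y\<rangle> < 1 + \<epsilon> \<longrightarrow> \<langle>y, e\<rangle> < 0"
    using assms by (intro eventually_ball_finite ballI eventually_hyp_near_negative)
      (auto simp: open_polar_cone_def)
  hence "\<forall>\<^sub>F \<epsilon> in at_right 0. 0 < \<epsilon> \<and> (\<forall>e\<in>N. \<forall>y\<in>hyp n. - \<langle>x, y\<rangle> < 1 + \<epsilon> \<longrightarrow> \<langle>y, e\<rangle> < 0)"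
    using eventually_at_right_less[of 0] by eventually_elim blast
  then obtain \<epsilon> where "0 < \<epsilon>" "\<forall>e\<in>N. \<forall>y\<in>hyp n. - \<langle>x, y\<rangle> < 1 + \<epsilon> \<longrightarrow> \<langle>y, e\<rangle> < 0"
    using eventually_happens'[OF trivial_limit_at_right_real] by blast
  thus thesis by (intro that) (auto simp: open_polar_cone_def hyp_def)
qed

lemma h_int_polar_cone:
  assumes N: "finite N" "\<And>e. e \<in> N \<Longrightarrow> is_vec n e" "\<And>e. e \<in> N \<Longrightarrow> \<langle>e, e\<rangle> > 0"
  shows "h_int n (hyp n) (hyp n \<inter> polar_cone N) = hyp n \<inter> open_polar_cone N"
proof (intro equalityI subsetI)
  fix x assume "x \<in> h_int n (hyp n) (hyp n \<inter> polar_cone N)"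
  then obtain \<epsilon> where x: "x \<in> hyp n" "x \<in> polar_cone N" and \<epsilon>: "\<epsilon> > 0"
      "\<And>y. y \<in> hyp n \<Longrightarrow> - \<langle>x, y\<rangle> < 1 + \<epsilon> \<Longrightarrow> y \<in> polar_cone N"
    by (auto simp: h_int_def)
  have "\<langle>x, e\<rangle> < 0" if e: "e \<in> N" for e
  proof (rule ccontr)
    assume nonneg: "\<not> \<langle>x, e\<rangle> < 0"
    obtain r s where rs: "r > 0" "s > 0" "r *\<^sub>R (x + s *\<^sub>R e) \<in> hyp n"
        "- \<langle>x, r *\<^sub>R (x + s *\<^sub>R e)\<rangle> < 1 + \<epsilon>"
      using hyp_perturb[OF x(1) N(2)[OF e] \<epsilon>(1)] .
    have "0 < r * (\<langle>x, e\<rangle> + s * \<langle>e, e\<rangle>)"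
      using nonneg rs(1,2) N(3)[OF e] by (intro mult_pos_pos add_nonneg_pos) auto
    thus False using polar_coneD[OF \<epsilon>(2)[OF rs(3,4)] e] by simp
  qed
  thus "x \<in> hyp n \<inter> open_polar_cone N"
    using x by (simp add: polar_cone_def open_polar_cone_def)
next
  fix x assume x: "x \<in> hyp n \<inter> open_polar_cone N"
  then obtain \<epsilon> where "\<epsilon> > 0" "\<And>y. y \<in> hyp n \<Longrightarrow> - \<langle>x, y\<rangle> < 1 + \<epsilon> \<Longrightarrow> y \<in> open_polar_cone N"
    using hyp_near_open_polar_cone[OF N(1,2)] by blast
  thus "x \<in> h_int n (hyp n) (hyp n \<inter> polar_cone N)"
    using x open_polar_cone_subset unfolding h_int_def by blast
qed

lemma open_polar_cone_dense:
  assumes p: "p \<in> open_polar_cone N" and x: "x \<in> hyp n \<inter> polar_cone N" and \<epsilon>: "\<epsilon> > 0"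
  shows "\<exists>y\<in>hyp n \<inter> open_polar_cone N. - \<langle>x, y\<rangle> < 1 + \<epsilon>"
proof -
  have "x \<in> hyp n" "is_vec n p" using x p by (simp_all add: open_polar_cone_def)
  then obtain r s where rs: "r > 0" "s > 0" "r *\<^sub>R (x + s *\<^sub>R p) \<in> hyp n"
      "- \<langle>x, r *\<^sub>R (x + s *\<^sub>R p)\<rangle> < 1 + \<epsilon>"
    using hyp_perturb \<epsilon> by blast
  have "\<langle>r *\<^sub>R (x + s *\<^sub>R p), e\<rangle> < 0" if e: "e \<in> N" for e
  proof -
    have "\<langle>x, e\<rangle> \<le> 0" "s * \<langle>p, e\<rangle> < 0"
      using x p e rs(2) by (auto simp: polar_cone_def open_polar_cone_def mult_pos_neg)
    hence "\<langle>x, e\<rangle> + s * \<langle>p, e\<rangle> < 0" by linarith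
    thus ?thesis using rs(1) by (simp add: mult_pos_neg)
  qed
  hence "r *\<^sub>R (x + s *\<^sub>R p) \<in> open_polar_cone N"
    using rs(3) by (simp add: open_polar_cone_def hyp_def)
  thus ?thesis using rs(3,4) by blast
qed

lemma h_closure_open_polar_cone:
  assumes N: "\<And>e. e \<in> N \<Longrightarrow> is_vec n e" and p: "p \<in> open_polar_cone N"
  shows "h_closure n (hyp n \<inter> open_polar_cone N) = hyp n \<inter> polar_cone N"
proof (intro equalityI subsetI)
  fix x assume "x \<in> h_closure n (hyp n \<inter> open_polar_cone N)"
  hence x: "x \<in> hyp n" "\<And>\<epsilon>. \<epsilon> > 0 \<Longrightarrow> \<exists>y\<in>hyp n \<inter> open_polar_cone N. - \<langle>x, y\<rangle> < 1 + \<epsilon>"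
    by (auto simp: h_closure_def)
  have "\<langle>x, e\<rangle> \<le> 0" if e: "e \<in> N" for e
  proof (rule ccontr)
    assume "\<not> \<langle>x, e\<rangle> \<le> 0"
    hence "x \<in> hyp n \<inter> open_polar_cone {- e}" using x(1) by (simp add: open_polar_cone_def hyp_def)
    then obtain \<epsilon> where \<epsilon>: "\<epsilon> > 0"
        "\<And>y. y \<in> hyp n \<Longrightarrow> - \<langle>x, y\<rangle> < 1 + \<epsilon> \<Longrightarrow> y \<in> open_polar_cone {- e}"
      using hyp_near_open_polar_cone[of "{- e}" x] N[OF e] by auto
    obtain y where "y \<in> hyp n" "y \<in> open_polar_cone N" "- \<langle>x, y\<rangle> < 1 + \<epsilon>"
      using x(2)[OF \<epsilon>(1)] by blast
    thus False
      using \<epsilon>(2)[of y] open_polar_coneD[of y N e] open_polar_coneD[of y "{- e}" "- e"] e by simp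
  qed
  thus "x \<in> hyp n \<inter> polar_cone N" using x(1) by (simp add: polar_cone_def hyp_def)
next
  fix x assume "x \<in> hyp n \<inter> polar_cone N"
  thus "x \<in> h_closure n (hyp n \<inter> open_polar_cone N)"
    using open_polar_cone_dense[OF p] by (simp add: h_closure_def)
qed

lemma wall_point_imp_side_normal:
  assumes N: "finite N" "\<And>f. f \<in> N \<Longrightarrow> is_vec n f" and e: "e \<in> N" "\<langle>e, e\<rangle> = 1"
    and x: "x \<in> hyp n" "\<langle>x, e\<rangle> = 0" "x \<in> open_polar_cone (N - {e})"
  shows "e \<in> side_normals n (hyp n \<inter> polar_cone N)"
proof -
  obtain \<epsilon> where \<epsilon>: "\<epsilon> > 0"
      "\<And>y. y \<in> hyp n \<Longrightarrow> - \<langle>x, y\<rangle> < 1 + \<epsilon> \<Longrightarrow> y \<in> open_polar_cone (N - {e})"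
    using N x hyp_near_open_polar_cone[of "N - {e}" x] by blast
  have near: "y \<in> polar_cone N" if y: "y \<in> hyp n" "\<langle>y, e\<rangle> = 0" "- \<langle>x, y\<rangle> < 1 + \<epsilon>" for y
    using \<epsilon>(2)[OF y(1,3)] y(2) by (force simp: polar_cone_def open_polar_cone_def)
  have "x \<in> polar_cone N" using near[OF x(1,2)] hypD(2)[OF x(1)] \<epsilon>(1) by simp
  hence "x \<in> h_int n (hyp n \<inter> {y. \<langle>y, e\<rangle> = 0}) (hyp n \<inter> polar_cone N \<inter> {y. \<langle>y, e\<rangle> = 0})"
    using x near \<epsilon>(1) unfolding h_int_def by blast
  thus ?thesis using N e by (auto simp: side_normals_def polar_cone_def)
qed

lemma supporting_wall_not_interior:
  assumes N: "finite N" "\<And>f. f \<in> N \<Longrightarrow> is_vec n f" and e: "is_vec n e" "\<langle>e, e\<rangle> > 0"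
    and supp: "\<And>y. y \<in> hyp n \<inter> polar_cone N \<Longrightarrow> \<langle>y, e\<rangle> \<le> 0" and x: "x \<in> hyp n" "\<langle>x, e\<rangle> = 0"
  shows "x \<notin> open_polar_cone N"
proof
  assume "x \<in> open_polar_cone N"
  then obtain \<epsilon> where \<epsilon>: "\<epsilon> > 0"
      "\<And>y. y \<in> hyp n \<Longrightarrow> - \<langle>x, y\<rangle> < 1 + \<epsilon> \<Longrightarrow> y \<in> open_polar_cone N"
    using hyp_near_open_polar_cone[OF N] x(1) by blast
  obtain r s where rs: "r > 0" "s > 0" "r *\<^sub>R (x + s *\<^sub>R e) \<in> hyp n"
      "- \<langle>x, r *\<^sub>R (x + s *\<^sub>R e)\<rangle> < 1 + \<epsilon>"
    using hyp_perturb[OF x(1) e(1) \<epsilon>(1)] .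
  hence "\<langle>r *\<^sub>R (x + s *\<^sub>R e), e\<rangle> \<le> 0"
    using supp \<epsilon>(2) open_polar_cone_subset by blast
  thus False using rs(1,2) x(2) e(2) by (simp add: mult_le_0_iff)
qed

lemma locally_nested_walls_not_crossing:
  assumes x: "x \<in> hyp n" "\<langle>x, e\<rangle> = 0" "\<langle>x, f\<rangle> = 0"
    and e: "is_vec n e" "\<langle>e, e\<rangle> = 1" and f: "is_vec n f" "\<langle>f, f\<rangle> = 1" and \<epsilon>: "\<epsilon> > 0"
    and nested: "\<And>y. y \<in> hyp n \<Longrightarrow> \<langle>y, e\<rangle> = 0 \<Longrightarrow> - \<langle>x, y\<rangle> < 1 + \<epsilon> \<Longrightarrow> \<langle>y, f\<rangle> \<le> 0"
  shows "1 \<le> \<bar>\<langle>e, f\<rangle>\<bar>"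
proof (rule ccontr)
  assume "\<not> 1 \<le> \<bar>\<langle>e, f\<rangle>\<bar>"
  hence pos: "1 - \<langle>e, f\<rangle>\<^sup>2 > 0" using abs_square_less_1[of "\<langle>e, f\<rangle>"] by simp
  define u where "u = f - \<langle>e, f\<rangle> *\<^sub>R e"
  have u: "is_vec n u" "\<langle>u, e\<rangle> = 0" "\<langle>u, f\<rangle> = 1 - \<langle>e, f\<rangle>\<^sup>2"
    using e f by (simp_all add: u_def lor_commute[of f e] power2_eq_square)
  obtain r s where rs: "r > 0" "s > 0" "r *\<^sub>R (x + s *\<^sub>R u) \<in> hyp n"
      "- \<langle>x, r *\<^sub>R (x + s *\<^sub>R u)\<rangle> < 1 + \<epsilon>"
    using hyp_perturb[OF x(1) u(1) \<epsilon>] .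
  have "\<langle>r *\<^sub>R (x + s *\<^sub>R u), f\<rangle> \<le> 0"
    using nested[OF rs(3) _ rs(4)] x(2) u(2) by simp
  thus False using rs(1,2) pos x(3) u(3) by (simp add: mult_le_0_iff)
qed

lemma side_normal_imp_mem:
  assumes N: "finite N" "\<And>f. f \<in> N \<Longrightarrow> is_vec n f" "\<And>f. f \<in> N \<Longrightarrow> \<langle>f, f\<rangle> = 1"
    and p: "p \<in> hyp n" "p \<in> open_polar_cone N"
    and e: "e \<in> side_normals n (hyp n \<inter> polar_cone N)"
  shows "e \<in> N"
proof -
  from e obtain x \<epsilon> where e: "is_vec n e" "\<langle>e, e\<rangle> = 1" "\<And>y. y \<in> hyp n \<inter> polar_cone N \<Longrightarrow> \<langle>y, e\<rangle> \<le> 0"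
    and x: "x \<in> hyp n" "x \<in> polar_cone N" "\<langle>x, e\<rangle> = 0" and \<epsilon>: "\<epsilon> > 0"
      "\<And>y. y \<in> hyp n \<Longrightarrow> \<langle>y, e\<rangle> = 0 \<Longrightarrow> - \<langle>x, y\<rangle> < 1 + \<epsilon> \<Longrightarrow> y \<in> polar_cone N"
    unfolding side_normals_def h_int_def by blast
  have "x \<notin> open_polar_cone N"
    using e x(1,3) by (intro supporting_wall_not_interior[OF N(1,2)]) auto
  then obtain f where f: "f \<in> N" "\<langle>x, f\<rangle> = 0"
    using x(2) by (force simp: polar_cone_def open_polar_cone_def)
  note F = N(2,3)[OF f(1)]
  have "1 \<le> \<bar>\<langle>e, f\<rangle>\<bar>"
    using \<epsilon>(2) f(1) polar_coneD
    by (intro locally_nested_walls_not_crossing[OF x(1,3) f(2) e(1,2) F \<epsilon>(1)]) blast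
  moreover have "e \<noteq> - f"
    using e(3)[of p] p open_polar_cone_subset[of N] open_polar_coneD[OF p(2) f(1)] by auto
  ultimately have "e = f"
    using meeting_walls_lor_less_1[OF hyp_timelike[OF x(1)], of e f] e f(2) x(3) F
    by (auto simp: lor_commute[of e x] lor_commute[of f x])
  thus ?thesis using f(1) by simp
qed

lemma side_normals_polar_cone:
  assumes N: "finite N" "\<And>e. e \<in> N \<Longrightarrow> is_vec n e" "\<And>e. e \<in> N \<Longrightarrow> \<langle>e, e\<rangle> = 1"
    and interior: "hyp n \<inter> open_polar_cone N \<noteq> {}"
    and walls: "\<And>e. e \<in> N \<Longrightarrow> \<exists>x\<in>hyp n. \<langle>x, e\<rangle> = 0 \<and> x \<in> open_polar_cone (N - {e})"
  shows "side_normals n (hyp n \<inter> polar_cone N) = N"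
proof (intro equalityI subsetI)
  fix e assume "e \<in> side_normals n (hyp n \<inter> polar_cone N)"
  thus "e \<in> N" using interior side_normal_imp_mem[OF N] by blast
next
  fix e assume "e \<in> N"
  thus "e \<in> side_normals n (hyp n \<inter> polar_cone N)"
    using walls wall_point_imp_side_normal[OF N(1,2)] N(3) by blast
qed

section \<open>Lorentzian matrices\<close>

abbreviation mat_vec_op ::
    "(nat \<Rightarrow> nat \<Rightarrow> real) \<Rightarrow> (nat \<Rightarrow> real) \<Rightarrow> nat \<Rightarrow> real"
    (infixr \<open>*v\<close> 75) where
  "A *v x \<equiv> mat_vec n A x"

abbreviation mat_mult_op ::
    "(nat \<Rightarrow> nat \<Rightarrow> real) \<Rightarrow> (nat \<Rightarrow> nat \<Rightarrow> real) \<Rightarrow> nat \<Rightarrow> nat \<Rightarrow> real"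
    (infixl \<open>**\<close> 75) where
  "A ** B \<equiv> mat_mult n A B"

lemma is_vec_mat_vec [simp]: "is_vec n (A *v x)"
  by (simp add: is_vec_def mat_vec_def)

lemma is_mat_mat_mult [simp]: "is_mat n (A ** B)"
  by (auto simp add: is_mat_def mat_mult_def)

lemma is_mat_idm [simp]: "is_mat n (idm n)"
  by (auto simp add: is_mat_def idm_def)

lemma linear_mat_vec: "linear (mat_vec n A)"
  by (rule linearI) (auto simp: mat_vec_def sum.distrib sum_distrib_left algebra_simps)

lemmas mat_vec_minus [simp] = linear_neg[OF linear_mat_vec]
  and mat_vec_scaleR [simp] = linear_scale[OF linear_mat_vec]
  and mat_vec_sum = linear_sum[OF linear_mat_vec]

lemma mat_vec_mat_mult [simp]: "(A ** B) *v x = A *v B *v x"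
proof
  fix i
  show "((A ** B) *v x) i = (A *v B *v x) i"
  proof (cases "i \<in> {1..n+1}")
    case True
    have "(\<Sum>j=1..n+1. (\<Sum>k=1..n+1. A i k * B k j) * x j)
        = (\<Sum>j=1..n+1. \<Sum>k=1..n+1. A i k * (B k j * x j))"
      by (simp add: sum_distrib_right mult.assoc del: sum.cl_ivl_Suc)
    also have "\<dots> = (\<Sum>k=1..n+1. \<Sum>j=1..n+1. A i k * (B k j * x j))"
      by (rule sum.swap)
    also have "\<dots> = (\<Sum>k=1..n+1. A i k * (\<Sum>j=1..n+1. B k j * x j))"
      by (simp add: sum_distrib_left del: sum.cl_ivl_Suc)
    finally show ?thesis
      using True unfolding mat_vec_def mat_mult_def
      by (auto intro!: sum.cong simp del: sum.cl_ivl_Suc)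
  qed (auto simp: mat_vec_def)
qed

lemma mat_vec_idm [simp]:
  assumes "is_vec n x" shows "idm n *v x = x"
proof
  fix i
  have "(\<Sum>j=1..n+1. idm n i j * x j) = (\<Sum>j=1..n+1. if i = j then x j else 0)" if "i \<in> {1..n+1}"
    using that by (intro sum.cong) (auto simp: idm_def)
  thus "(idm n *v x) i = x i"
    using assms
    by (cases "i \<in> {1..n+1}") (auto simp: mat_vec_def is_vec_def simp del: sum.cl_ivl_Suc)
qed

lemma is_vec_unit_vec [simp]: "j \<in> {1..n+1} \<Longrightarrow> is_vec n (unit_vec j)"
  by (auto simp: is_vec_def unit_vec_def)

lemma mat_vec_unit_vec:
  assumes "i \<in> {1..n+1}" "j \<in> {1..n+1}" shows "(A *v unit_vec j) i = A i j"
proof -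
  have "(\<Sum>k=1..n+1. A i k * unit_vec j k) = (\<Sum>k=1..n+1. if j = k then A i k else 0)"
    by (intro sum.cong) (auto simp: unit_vec_def)
  thus ?thesis using assms by (simp add: mat_vec_def del: sum.cl_ivl_Suc)
qed

lemma mat_eqI:
  assumes "is_mat n A" "is_mat n B" "\<And>x. is_vec n x \<Longrightarrow> A *v x = B *v x"
  shows "A = B"
proof (intro ext)
  fix i j
  show "A i j = B i j"
  proof (cases "i \<in> {1..n+1} \<and> j \<in> {1..n+1}")
    case True
    thus ?thesis
      using assms(3)[of "unit_vec j"] mat_vec_unit_vec[of i j A] mat_vec_unit_vec[of i j B] by simp
  next
    case False
    hence "A i j = 0" "B i j = 0" using assms(1,2) unfolding is_mat_def by blast+
    thus ?thesis by simp
  qed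
qed

definition to_mat :: "(nat \<Rightarrow> nat \<Rightarrow> real) \<Rightarrow> real mat" where
  "to_mat A = mat (n+1) (n+1) (\<lambda>(i, j). A (Suc i) (Suc j))"

lemma to_mat_mult: "to_mat (A ** B) = to_mat A * to_mat B"
proof (rule eq_matI)
  fix i j assume "i < dim_row (to_mat A * to_mat B)" "j < dim_col (to_mat A * to_mat B)"
  hence ij: "i < n+1" "j < n+1" by (simp_all add: to_mat_def)
  hence "to_mat (A ** B) $$ (i, j) = (\<Sum>k=1..n+1. A (Suc i) k * B k (Suc j))"
    by (simp add: to_mat_def mat_mult_def del: sum.cl_ivl_Suc)
  also have "\<dots> = (\<Sum>k=0..<n+1. A (Suc i) (Suc k) * B (Suc k) (Suc j))"
    using sum.shift_bounds_Suc_ivl[of "\<lambda>k. A (Suc i) k * B k (Suc j)" 0 "n+1"]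
    by (simp only: One_nat_def Suc_eq_plus1[symmetric] atLeastLessThanSuc_atLeastAtMost)
  also have "\<dots> = (to_mat A * to_mat B) $$ (i, j)"
    using ij by (simp add: to_mat_def scalar_prod_def del: sum.op_ivl_Suc)
  finally show "to_mat (A ** B) $$ (i, j) = (to_mat A * to_mat B) $$ (i, j)" .
qed (simp_all add: to_mat_def)

lemma to_mat_idm: "to_mat (idm n) = 1\<^sub>m (n+1)"
  by (rule eq_matI) (auto simp: to_mat_def idm_def)

lemma to_mat_inject:
  assumes "is_mat n A" "is_mat n B" and eq: "to_mat A = to_mat B"
  shows "A = B"
proof (intro ext)
  fix i j
  show "A i j = B i j"
  proof (cases "i \<in> {1..n+1} \<and> j \<in> {1..n+1}")
    case True
    hence "i - 1 < n+1" "j - 1 < n+1" "Suc (i - 1) = i" "Suc (j - 1) = j" by auto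
    hence entry: "to_mat X $$ (i - 1, j - 1) = X i j" for X
      unfolding to_mat_def by (simp only: index_mat split_conv)
    show ?thesis using arg_cong[OF eq, of "\<lambda>M. M $$ (i - 1, j - 1)"] unfolding entry .
  next
    case False
    hence "A i j = 0" "B i j = 0" using assms(1,2) unfolding is_mat_def by blast+
    thus ?thesis by simp
  qed
qed

lemma mat_mult_eq_idm_commute:
  assumes "A ** B = idm n" shows "B ** A = idm n"
proof (rule to_mat_inject)
  have carrier: "to_mat X \<in> carrier_mat (n+1) (n+1)" for X by (simp add: to_mat_def)
  have "to_mat A * to_mat B = 1\<^sub>m (n+1)" by (simp add: assms to_mat_idm flip: to_mat_mult)
  hence "to_mat B * to_mat A = 1\<^sub>m (n+1)" by (rule mat_mult_left_right_inverse[OF carrier carrier])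
  thus "to_mat (B ** A) = to_mat (idm n)" by (simp add: to_mat_mult to_mat_idm)
qed simp_all

definition time_sign :: "nat \<Rightarrow> real" where
  "time_sign i = (if i = n+1 then -1 else 1)"

definition adj :: "(nat \<Rightarrow> nat \<Rightarrow> real) \<Rightarrow> nat \<Rightarrow> nat \<Rightarrow> real" where
  "adj A = (\<lambda>i j. time_sign i * time_sign j * A j i)"

lemma time_sign_square [simp]: "time_sign i * time_sign i = 1" "time_sign i * (time_sign i * r) = r"
  by (simp_all add: time_sign_def)

lemma lor_eq_sum: "\<langle>x, y\<rangle> = (\<Sum>i=1..n+1. time_sign i * x i * y i)"
proof -
  have "(\<Sum>i=1..n. time_sign i * x i * y i) = (\<Sum>i=1..n. x i * y i)"
    by (intro sum.cong) (auto simp: time_sign_def)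
  thus ?thesis by (simp add: lor_def time_sign_def)
qed

lemma lor_unit_vec_right:
  assumes "i \<in> {1..n+1}" shows "\<langle>x, unit_vec i\<rangle> = time_sign i * x i"
proof -
  have "\<langle>x, unit_vec i\<rangle> = (\<Sum>j=1..n+1. if i = j then time_sign j * x j else 0)"
    unfolding lor_eq_sum by (intro sum.cong) (auto simp: unit_vec_def)
  thus ?thesis using assms by (simp del: sum.cl_ivl_Suc)
qed

lemma lor_space_unit_vec: "i \<in> {1..n} \<Longrightarrow> \<langle>x, unit_vec i\<rangle> = x i"
  and lor_time_unit_vec: "\<langle>x, unit_vec (n+1)\<rangle> = - x (n+1)"
  using lor_unit_vec_right[of i x] lor_unit_vec_right[of "n+1" x] by (simp_all add: time_sign_def)

lemma lor_nondegenerate: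
  assumes "is_vec n x" "is_vec n y" "\<And>z. is_vec n z \<Longrightarrow> \<langle>x, z\<rangle> = \<langle>y, z\<rangle>"
  shows "x = y"
proof (rule is_vec_eqI)
  show "x i = y i" if "i \<in> {1..n}" for i
    using assms(3)[of "unit_vec i"] that by (simp add: lor_space_unit_vec)
  show "x (n+1) = y (n+1)"
    using assms(3)[of "unit_vec (n+1)"] lor_time_unit_vec[of x] lor_time_unit_vec[of y] by simp
qed (rule assms)+

lemma is_mat_adj: "is_mat n A \<Longrightarrow> is_mat n (adj A)"
  unfolding is_mat_def adj_def by (metis mult_zero_right)

lemma lor_mat_vec_left: "\<langle>A *v x, y\<rangle> = \<langle>x, adj A *v y\<rangle>"
proof -
  have "\<langle>A *v x, y\<rangle> = (\<Sum>i=1..n+1. \<Sum>j=1..n+1. time_sign i * A i j * x j * y i)"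
    unfolding lor_eq_sum mat_vec_def
    by (intro sum.cong)
      (auto simp: sum_distrib_left sum_distrib_right mult_ac simp del: sum.cl_ivl_Suc)
  also have "\<dots> = (\<Sum>j=1..n+1. \<Sum>i=1..n+1. time_sign i * A i j * x j * y i)"
    by (rule sum.swap)
  also have "\<dots> = \<langle>x, adj A *v y\<rangle>"
    unfolding lor_eq_sum mat_vec_def adj_def
    by (intro sum.cong)
      (auto simp: sum_distrib_left sum_distrib_right mult_ac simp del: sum.cl_ivl_Suc)
  finally show ?thesis .
qed

lemma lor_mat_vec_right: "\<langle>x, A *v y\<rangle> = \<langle>adj A *v x, y\<rangle>"
  by (metis lor_commute lor_mat_vec_left)

lemma lorentzian_is_mat: "lorentzian n A \<Longrightarrow> is_mat n A"
  by (simp add: lorentzian_def)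

lemma lorentzian_lor:
  "lorentzian n A \<Longrightarrow> is_vec n x \<Longrightarrow> is_vec n y \<Longrightarrow> \<langle>A *v x, A *v y\<rangle> = \<langle>x, y\<rangle>"
  by (simp add: lorentzian_def)

lemma adj_mult_lorentzian:
  assumes "lorentzian n A" shows "adj A ** A = idm n"
proof (rule mat_eqI)
  fix x assume x: "is_vec n x"
  have "adj A *v A *v x = x"
    by (rule lor_nondegenerate)
      (use assms x in \<open>auto simp: lorentzian_lor simp flip: lor_mat_vec_right\<close>)
  thus "(adj A ** A) *v x = idm n *v x" using x by simp
qed simp_all

lemma mult_adj_lorentzian: "lorentzian n A \<Longrightarrow> A ** adj A = idm n"
  by (rule mat_mult_eq_idm_commute[OF adj_mult_lorentzian])

lemma mat_vec_adj_cancel [simp]: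
  assumes "lorentzian n A" "is_vec n x"
  shows "adj A *v A *v x = x" "A *v adj A *v x = x"
  using adj_mult_lorentzian[OF assms(1)] mult_adj_lorentzian[OF assms(1)] assms(2)
  by (metis mat_vec_idm mat_vec_mat_mult)+

lemma lorentzian_adj:
  assumes "lorentzian n A" shows "lorentzian n (adj A)"
  unfolding lorentzian_def
  using assms is_mat_adj[OF lorentzian_is_mat[OF assms]] by (simp flip: lor_mat_vec_left)

lemma lorentzian_mult: "lorentzian n A \<Longrightarrow> lorentzian n B \<Longrightarrow> lorentzian n (A ** B)"
  by (simp add: lorentzian_def)

lemma lorentzian_idm: "lorentzian n (idm n)"
  by (simp add: lorentzian_def)

lemma right_inverse_eq_adj:
  assumes "lorentzian n A" "is_mat n B" "A ** B = idm n"
  shows "B = adj A"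
proof (rule mat_eqI)
  fix x assume x: "is_vec n x"
  have "A *v B *v x = x" using assms(3) x by (metis mat_vec_idm mat_vec_mat_mult)
  thus "B *v x = adj A *v x"
    using mat_vec_adj_cancel(1)[OF assms(1), of "B *v x"] by simp
qed (use assms in \<open>auto simp: is_mat_adj lorentzian_is_mat\<close>)

lemma adj_mult_eq_idm_imp_eq:
  assumes A: "lorentzian n A" and B: "lorentzian n B" and eq: "adj B ** A = idm n"
  shows "A = B"
proof (rule mat_eqI)
  fix x assume x: "is_vec n x"
  have "adj B *v A *v x = x" using eq x by (metis mat_vec_idm mat_vec_mat_mult)
  thus "A *v x = B *v x" using mat_vec_adj_cancel(2)[OF B, of "A *v x"] by simp
qed (use A B in \<open>simp_all add: lorentzian_is_mat\<close>)

lemma positive_lorentzian_iff: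
  "positive_lorentzian n A \<longleftrightarrow> lorentzian n A \<and>
    (\<forall>x. is_vec n x \<longrightarrow> \<langle>x, x\<rangle> < 0 \<longrightarrow> x (n+1) > 0 \<longrightarrow> (A *v x) (n+1) > 0)"
proof (intro iffI conjI allI impI)
  fix x assume "positive_lorentzian n A" "is_vec n x" "\<langle>x, x\<rangle> < 0" "x (n+1) > 0"
  hence "sgn ((A *v x) (n+1)) = 1" by (simp add: positive_lorentzian_def)
  thus "(A *v x) (n+1) > 0" by (simp add: sgn_1_pos)
next
  assume A: "lorentzian n A \<and>
    (\<forall>x. is_vec n x \<longrightarrow> \<langle>x, x\<rangle> < 0 \<longrightarrow> x (n+1) > 0 \<longrightarrow> (A *v x) (n+1) > 0)"
  have "sgn ((A *v x) (n+1)) = sgn (x (n+1))" if x: "is_vec n x" "\<langle>x, x\<rangle> < 0" for x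
  proof -
    have "spatial_norm x < \<bar>x (n+1)\<bar>" using x(2) by (simp only: timelike_iff)
    hence "\<bar>x (n+1)\<bar> > 0" using L2_set_nonneg by (rule order_le_less_trans[rotated])
    then consider "x (n+1) > 0" | "- x (n+1) > 0" by linarith
    thus ?thesis
    proof cases
      case 1
      thus ?thesis using A x by simp
    next
      case 2
      have "is_vec n (- x) \<longrightarrow> \<langle>- x, - x\<rangle> < 0 \<longrightarrow> (- x) (n+1) > 0 \<longrightarrow> (A *v (- x)) (n+1) > 0"
        using A by blast
      thus ?thesis using 2 x by (simp add: sgn_if)
    qed
  qed
  thus "positive_lorentzian n A" using A by (simp add: positive_lorentzian_def)
qed (simp add: positive_lorentzian_def)

lemma positive_lorentzian_future:
  "positive_lorentzian n A \<Longrightarrow> is_vec n x \<Longrightarrow> \<langle>x, x\<rangle> < 0 \<Longrightarrow> x (n+1) > 0 \<Longrightarrow> (A *v x) (n+1) > 0"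
  by (simp add: positive_lorentzian_iff)

lemma positive_lorentzian_idm: "positive_lorentzian n (idm n)"
  by (simp add: positive_lorentzian_def lorentzian_idm)

lemma positive_lorentzian_adj:
  assumes "positive_lorentzian n A" shows "positive_lorentzian n (adj A)"
proof -
  have A: "lorentzian n A" using assms by (simp add: positive_lorentzian_def)
  have "(adj A *v x) (n+1) > 0" if x: "is_vec n x" "\<langle>x, x\<rangle> < 0" "x (n+1) > 0" for x
  proof -
    have "\<langle>adj A *v x, adj A *v x\<rangle> < 0" using A x by (simp add: lorentzian_lor lorentzian_adj)
    hence "sgn ((A *v adj A *v x) (n+1)) = sgn ((adj A *v x) (n+1))"
      using assms is_vec_mat_vec unfolding positive_lorentzian_def by blast
    hence "sgn ((adj A *v x) (n+1)) = 1" using A x by simp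
    thus ?thesis by (simp only: sgn_1_pos)
  qed
  thus ?thesis using A by (simp add: positive_lorentzian_iff lorentzian_adj)
qed

lemma positive_lorentzian_mult:
  "positive_lorentzian n A \<Longrightarrow> positive_lorentzian n B \<Longrightarrow> positive_lorentzian n (A ** B)"
  unfolding positive_lorentzian_iff by (simp add: lorentzian_mult lorentzian_lor)

lemma hyp_mat_vec: "positive_lorentzian n A \<Longrightarrow> x \<in> hyp n \<Longrightarrow> A *v x \<in> hyp n"
  by (auto simp: hyp_def positive_lorentzian_iff lorentzian_lor)

section \<open>Reflections and groups of Lorentzian matrices\<close>

definition reflect :: "(nat \<Rightarrow> real) \<Rightarrow> (nat \<Rightarrow> real) \<Rightarrow> nat \<Rightarrow> real" where
  "reflect w x = x - (2 / \<langle>w, w\<rangle> * \<langle>x, w\<rangle>) *\<^sub>R w"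

lemma is_vec_reflect [simp]: "is_vec n w \<Longrightarrow> is_vec n x \<Longrightarrow> is_vec n (reflect w x)"
  by (simp add: reflect_def)

lemma is_mat_hrefl [simp]: "is_mat n (hrefl n w)"
  by (auto simp: is_mat_def hrefl_def lin_refl_def)

lemma mat_vec_hrefl:
  assumes "is_vec n w" "is_vec n x"
  shows "hrefl n w *v x = reflect w x"
proof
  fix i
  show "(hrefl n w *v x) i = reflect w x i"
  proof (cases "i \<in> {1..n+1}")
    case True
    let ?c = "2 / \<langle>w, w\<rangle>"
    have "(hrefl n w *v x) i = (\<Sum>j=1..n+1. idm n i j * x j - ?c * w i * (time_sign j * x j * w j))"
      unfolding mat_vec_def hrefl_def lin_refl_def if_P[OF True]
      by (intro sum.cong) (use True in \<open>auto simp: time_sign_def algebra_simps\<close>)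
    also have "\<dots> = (idm n *v x) i - ?c * w i * \<langle>x, w\<rangle>"
      unfolding lor_eq_sum[of x w] sum_subtractf sum_distrib_left mat_vec_def if_P[OF True] ..
    finally show ?thesis using assms by (simp add: reflect_def)
  qed (use assms is_vec_mat_vec[of "hrefl n w" x] in \<open>simp add: is_vec_def reflect_def\<close>)
qed

lemma lor_reflect:
  assumes "\<langle>w, w\<rangle> \<noteq> 0" shows "\<langle>reflect w x, reflect w y\<rangle> = \<langle>x, y\<rangle>"
  using assms by (simp add: reflect_def lor_commute[of w y] field_simps)

lemma reflect_reflect:
  assumes "\<langle>w, w\<rangle> \<noteq> 0" shows "reflect w (reflect w x) = x"
  using assms by (simp add: reflect_def fun_eq_iff field_simps)

lemma lorentzian_hrefl:
  assumes "is_vec n w" "\<langle>w, w\<rangle> \<noteq> 0" shows "lorentzian n (hrefl n w)"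
  using assms by (simp add: lorentzian_def mat_vec_hrefl lor_reflect)

lemma positive_lorentzian_hrefl:
  assumes w: "is_vec n w" "\<langle>w, w\<rangle> > 0"
  shows "positive_lorentzian n (hrefl n w)"
proof -
  have "reflect w x (n+1) > 0" if x: "is_vec n x" "\<langle>x, x\<rangle> < 0" "x (n+1) > 0" for x
  proof -
    have "\<langle>reflect w x, x\<rangle> = \<langle>x, x\<rangle> - 2 / \<langle>w, w\<rangle> * \<langle>x, w\<rangle>\<^sup>2"
      by (simp add: reflect_def lor_commute[of w x] power2_eq_square)
    also have "\<dots> \<le> \<langle>x, x\<rangle>" using w(2) by simp
    also have "\<dots> < 0" by (rule x(2))
    finally show ?thesis
      using timelike_causal_sign_iff[of x "reflect w x"] x w(2) by (simp add: lor_reflect)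
  qed
  thus ?thesis using w by (simp add: positive_lorentzian_iff lorentzian_hrefl mat_vec_hrefl)
qed

definition lorentzian_group :: "(nat \<Rightarrow> nat \<Rightarrow> real) set \<Rightarrow> bool" where
  "lorentzian_group G \<longleftrightarrow> idm n \<in> G \<and> (\<forall>A\<in>G. lorentzian n A \<and> adj A \<in> G) \<and> (\<forall>A\<in>G. \<forall>B\<in>G. A ** B \<in> G)"

lemma lorentzian_groupD:
  assumes "lorentzian_group G"
  shows "idm n \<in> G" "A \<in> G \<Longrightarrow> lorentzian n A" "A \<in> G \<Longrightarrow> adj A \<in> G"
    "A \<in> G \<Longrightarrow> B \<in> G \<Longrightarrow> A ** B \<in> G"
  using assms by (simp_all add: lorentzian_group_def)

lemma gen_grp_subset:
  assumes G: "lorentzian_group G" and S: "S \<subseteq> G"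
  shows "gen_grp n S \<subseteq> G"
proof
  fix A assume "A \<in> gen_grp n S"
  thus "A \<in> G"
  proof induction
    case (gen_inv A B)
    hence "B = adj A" using lorentzian_groupD(2)[OF G] by (intro right_inverse_eq_adj)
    thus ?case using lorentzian_groupD(3)[OF G] gen_inv by simp
  qed (use S lorentzian_groupD[OF G] in auto)
qed

lemma lorentzian_group_gen_grp:
  assumes G: "lorentzian_group G" and S: "S \<subseteq> G"
  shows "lorentzian_group (gen_grp n S)"
  unfolding lorentzian_group_def
proof (intro conjI ballI)
  fix A assume A: "A \<in> gen_grp n S"
  show lor: "lorentzian n A" using gen_grp_subset[OF assms] A lorentzian_groupD(2)[OF G] by blast
  show "adj A \<in> gen_grp n S"
    using A is_mat_adj[OF lorentzian_is_mat[OF lor]] mult_adj_lorentzian[OF lor] by (rule gen_inv)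
qed (auto intro: gen_id gen_mult)

text \<open>An element of \<open>G\<close> maximising \<open>\<langle>x, A *v \<rho>\<rangle>\<close> does the job: no further reflection can bring the
  orbit point of \<open>\<rho>\<close> closer to \<open>x\<close>.\<close>
lemma ex_translate_in_polar_cone:
  assumes G: "lorentzian_group G" and refl: "\<And>w. w \<in> R \<Longrightarrow> hrefl n w \<in> G"
    and R: "\<And>w. w \<in> R \<Longrightarrow> is_vec n w" "\<And>w. w \<in> R \<Longrightarrow> \<langle>w, w\<rangle> > 0"
    and \<rho>: "\<rho> \<in> open_polar_cone R"
    and fin: "finite ((\<lambda>A. A *v \<rho>) ` {A \<in> G. \<langle>x, \<rho>\<rangle> \<le> \<langle>x, A *v \<rho>\<rangle>})"
  shows "\<exists>A\<in>G. A *v x \<in> polar_cone R"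
proof -
  note G = lorentzian_groupD[OF G]
  have \<rho>_vec: "is_vec n \<rho>" using \<rho> by (simp add: open_polar_cone_def)
  let ?f = "\<lambda>A. \<langle>x, A *v \<rho>\<rangle>"
  define S where "S = {A \<in> G. \<langle>x, \<rho>\<rangle> \<le> ?f A}"
  have "finite (?f ` S)" using finite_imageI[OF fin, of "lor n x"] by (simp add: S_def image_image)
  moreover have "idm n \<in> S" using G(1) \<rho>_vec by (simp add: S_def)
  ultimately have "Max (?f ` S) \<in> ?f ` S" "\<And>B. B \<in> S \<Longrightarrow> ?f B \<le> Max (?f ` S)"
    by (blast intro: Max_in) (simp add: \<open>finite (?f ` S)\<close>)
  then obtain A where A: "A \<in> S" "\<And>B. B \<in> S \<Longrightarrow> ?f B \<le> ?f A" by auto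
  have max: "?f B \<le> ?f A" if "B \<in> G" for B
    using A that by (cases "B \<in> S") (auto simp: S_def)
  have AG: "A \<in> G" using A(1) by (simp add: S_def)
  have "\<langle>adj A *v x, w\<rangle> \<le> 0" if w: "w \<in> R" for w
  proof (rule ccontr)
    assume pos: "\<not> \<langle>adj A *v x, w\<rangle> \<le> 0"
    have "?f (A ** hrefl n w) \<le> ?f A" using G(4)[OF AG refl[OF w]] by (rule max)
    hence "0 \<le> 2 / \<langle>w, w\<rangle> * \<langle>\<rho>, w\<rangle> * \<langle>adj A *v x, w\<rangle>"
      using R(1)[OF w] \<rho>_vec by (simp add: mat_vec_hrefl lor_mat_vec_right reflect_def)
    moreover have "2 / \<langle>w, w\<rangle> * \<langle>\<rho>, w\<rangle> * \<langle>adj A *v x, w\<rangle> < 0"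
      using R(2)[OF w] open_polar_coneD[OF \<rho> w] pos by (intro mult_neg_pos mult_pos_neg) auto
    ultimately show False by linarith
  qed
  hence "adj A *v x \<in> polar_cone R" by (simp add: polar_cone_def)
  thus ?thesis using G(3)[OF AG] by blast
qed

section \<open>Integral vectors and matrices\<close>

definition int_vec :: "(nat \<Rightarrow> real) \<Rightarrow> bool" where
  "int_vec x \<longleftrightarrow> is_vec n x \<and> (\<forall>i. x i \<in> \<int>)"

lemma int_vec_is_vec [simp]: "int_vec x \<Longrightarrow> is_vec n x"
  and int_vec_Ints [intro]: "int_vec x \<Longrightarrow> x i \<in> \<int>"
  by (simp_all add: int_vec_def)

lemma int_vec_add [intro]: "int_vec x \<Longrightarrow> int_vec y \<Longrightarrow> int_vec (x + y)"
  and int_vec_diff [intro]: "int_vec x \<Longrightarrow> int_vec y \<Longrightarrow> int_vec (x - y)"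
  and int_vec_minus [intro]: "int_vec x \<Longrightarrow> int_vec (- x)"
  and int_vec_scaleR [intro]: "r \<in> \<int> \<Longrightarrow> int_vec x \<Longrightarrow> int_vec (r *\<^sub>R x)"
  by (auto simp: int_vec_def)

lemma int_vec_unit_vec [intro]: "i \<in> {1..n+1} \<Longrightarrow> int_vec (unit_vec i)"
  by (auto simp: int_vec_def is_vec_def unit_vec_def)

lemma lor_Ints [intro]: "int_vec x \<Longrightarrow> int_vec y \<Longrightarrow> \<langle>x, y\<rangle> \<in> \<int>"
  unfolding lor_def by (intro Ints_diff Ints_sum Ints_mult) auto

lemma int_vec_reflect:
  assumes "2 / \<langle>w, w\<rangle> \<in> \<int>" "int_vec w" "int_vec x" shows "int_vec (reflect w x)"
  unfolding reflect_def using assms by (intro int_vec_diff int_vec_scaleR Ints_mult lor_Ints)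

lemma Gamma_positive_lorentzian: "A \<in> Gamma n \<Longrightarrow> positive_lorentzian n A"
  and Gamma_lorentzian [simp]: "A \<in> Gamma n \<Longrightarrow> lorentzian n A"
  and Gamma_Ints: "A \<in> Gamma n \<Longrightarrow> A i j \<in> \<int>"
  by (simp_all add: Gamma_def positive_lorentzian_def)

lemma Gamma_int_vec [intro]:
  assumes "A \<in> Gamma n" "int_vec x" shows "int_vec (A *v x)"
proof -
  have "(\<Sum>j=1..n+1. A i j * x j) \<in> \<int>" for i
    using assms(2) by (intro Ints_sum Ints_mult Gamma_Ints[OF assms(1)]) auto
  hence "(A *v x) i \<in> \<int>" for i by (simp add: mat_vec_def del: sum.cl_ivl_Suc)
  thus ?thesis by (simp add: int_vec_def)
qed

lemma Gamma_group: "lorentzian_group (Gamma n)"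
  unfolding lorentzian_group_def
proof (intro conjI ballI)
  have "idm n i j \<in> \<int>" for i j by (simp add: idm_def)
  thus "idm n \<in> Gamma n" using positive_lorentzian_idm by (simp add: Gamma_def)
next
  fix A assume A: "A \<in> Gamma n"
  show "lorentzian n A" using A by simp
  have "adj A i j \<in> \<int>" for i j using Gamma_Ints[OF A, of j i] by (simp add: adj_def time_sign_def)
  thus "adj A \<in> Gamma n" using A by (simp add: Gamma_def positive_lorentzian_adj)
next
  fix A B assume AB: "A \<in> Gamma n" "B \<in> Gamma n"
  have "(\<Sum>k=1..n+1. A i k * B k j) \<in> \<int>" for i j
    by (intro Ints_sum Ints_mult Gamma_Ints[OF AB(1)] Gamma_Ints[OF AB(2)])
  hence "(A ** B) i j \<in> \<int>" for i j by (simp add: mat_mult_def del: sum.cl_ivl_Suc)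
  thus "A ** B \<in> Gamma n" using AB by (simp add: Gamma_def positive_lorentzian_mult)
qed

lemma Gamma_hyp: "A \<in> Gamma n \<Longrightarrow> x \<in> hyp n \<Longrightarrow> A *v x \<in> hyp n"
  by (rule hyp_mat_vec[OF Gamma_positive_lorentzian])

lemma Gamma_hrefl:
  assumes w: "int_vec w" "\<langle>w, w\<rangle> > 0" and c: "2 / \<langle>w, w\<rangle> \<in> \<int>"
  shows "hrefl n w \<in> Gamma n"
  unfolding Gamma_def
proof (intro CollectI conjI allI)
  show "positive_lorentzian n (hrefl n w)" using w by (intro positive_lorentzian_hrefl) auto
  fix i j
  have "2 / \<langle>w, w\<rangle> * w i * (if j = n+1 then - w j else w j) \<in> \<int>"
    using w(1) by (intro Ints_mult c) auto
  thus "hrefl n w i j \<in> \<int>" by (simp add: hrefl_def lin_refl_def idm_def)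
qed

lemma Gamma2_iff:
  "A \<in> Gamma2 n \<longleftrightarrow> A \<in> Gamma n \<and> (\<forall>x i. int_vec x \<longrightarrow> [(A *v x) i = x i] (rmod 2))"
proof -
  have "(\<forall>i\<in>{1..n+1}. \<forall>j\<in>{1..n+1}. [A i j = idm n i j] (rmod 2)) \<longleftrightarrow>
      (\<forall>x i. int_vec x \<longrightarrow> [(A *v x) i = x i] (rmod 2))" (is "?L \<longleftrightarrow> ?R")
  proof (intro iffI allI ballI impI)
    fix x i assume L: ?L and x: "int_vec x"
    show "[(A *v x) i = x i] (rmod 2)"
    proof (cases "i \<in> {1..n+1}")
      case True
      have "[A i j * x j = idm n i j * x j] (rmod 2)" if j: "j \<in> {1..n+1}" for j
      proof -
        have "(A i j - idm n i j) / 2 * x j \<in> \<int>"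
          using L True j x by (intro Ints_mult) (auto simp: rcong_2_iff)
        thus ?thesis by (simp add: rcong_2_iff left_diff_distrib)
      qed
      hence "[(A *v x) i = (idm n *v x) i] (rmod 2)"
        using True unfolding mat_vec_def if_P[OF True] by (intro rcong_sum)
      thus ?thesis using x by simp
    qed (use x is_vec_mat_vec[of A x] int_vec_is_vec[OF x] in \<open>simp add: is_vec_def\<close>)
  next
    fix i j assume R: ?R and ij: "i \<in> {1..n+1}" "j \<in> {1..n+1}"
    have "[(A *v unit_vec j) i = unit_vec j i] (rmod 2)"
      using R int_vec_unit_vec[OF ij(2)] by blast
    thus "[A i j = idm n i j] (rmod 2)"
      using ij mat_vec_unit_vec[OF ij] by (simp add: idm_def unit_vec_def eq_commute)
  qed
  thus ?thesis unfolding Gamma2_def mem_Collect_eq rcong_2_iff_ex_int[symmetric]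
    by (rule conj_cong[OF refl])
qed

lemma Gamma2I: "A \<in> Gamma n \<Longrightarrow> (\<And>x i. int_vec x \<Longrightarrow> [(A *v x) i = x i] (rmod 2)) \<Longrightarrow> A \<in> Gamma2 n"
  and Gamma2_Gamma [simp]: "A \<in> Gamma2 n \<Longrightarrow> A \<in> Gamma n"
  and Gamma2_rcong: "A \<in> Gamma2 n \<Longrightarrow> int_vec x \<Longrightarrow> [(A *v x) i = x i] (rmod 2)"
  by (simp_all add: Gamma2_iff)

lemma Gamma2_group: "lorentzian_group (Gamma2 n)"
  unfolding lorentzian_group_def
proof (intro conjI ballI)
  show "idm n \<in> Gamma2 n" using lorentzian_groupD(1)[OF Gamma_group] by (rule Gamma2I) simp
next
  fix A assume A: "A \<in> Gamma2 n"
  show "lorentzian n A" using A by simp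
  have adj: "adj A \<in> Gamma n" using lorentzian_groupD(3)[OF Gamma_group] A by simp
  have "[(adj A *v x) i = x i] (rmod 2)" if x: "int_vec x" for x i
    using Gamma2_rcong[OF A Gamma_int_vec[OF adj x], of i] A x by (simp add: rcong_sym_iff)
  with adj show "adj A \<in> Gamma2 n" by (rule Gamma2I)
next
  fix A B assume AB: "A \<in> Gamma2 n" "B \<in> Gamma2 n"
  have "[(A *v B *v x) i = x i] (rmod 2)" if x: "int_vec x" for x i
    using Gamma2_rcong[OF AB(1) Gamma_int_vec[OF Gamma2_Gamma[OF AB(2)] x]] Gamma2_rcong[OF AB(2) x]
    by (rule rcong_trans)
  thus "A ** B \<in> Gamma2 n"
    using lorentzian_groupD(4)[OF Gamma_group, of A B] AB by (intro Gamma2I) simp_all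
qed

lemma Gamma2_hrefl:
  assumes "int_vec w" "\<langle>w, w\<rangle> = 1" shows "hrefl n w \<in> Gamma2 n"
proof -
  have "[(hrefl n w *v x) i = x i] (rmod 2)" if x: "int_vec x" for x i
  proof -
    have "- (\<langle>x, w\<rangle> * w i) \<in> \<int>" using assms x by (intro Ints_minus Ints_mult lor_Ints) auto
    thus ?thesis using assms x by (simp add: rcong_2_iff mat_vec_hrefl reflect_def)
  qed
  thus ?thesis using assms Gamma_hrefl by (intro Gamma2I) simp_all
qed

lemma timelike_coordinate_bound:
  assumes v: "\<langle>v, v\<rangle> < 0"
  shows "\<exists>L. \<forall>u. \<langle>u, u\<rangle> \<le> K \<and> \<bar>\<langle>u, v\<rangle>\<bar> \<le> C \<longrightarrow> (\<forall>i\<in>{1..n+1}. \<bar>u i\<bar> \<le> L)"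
proof -
  define k s t where "k = sqrt \<bar>K\<bar>" and "s = spatial_norm v" and "t = \<bar>v (n+1)\<bar>"
  define M where "M = (s * k + C) / (t - s)"
  have st: "0 \<le> s" "s < t" using v by (simp_all add: s_def t_def timelike_iff)
  have k: "0 \<le> k" "k\<^sup>2 = \<bar>K\<bar>" by (simp_all add: k_def)
  have "\<bar>u i\<bar> \<le> M + k" if u: "\<langle>u, u\<rangle> \<le> K" "\<bar>\<langle>u, v\<rangle>\<bar> \<le> C" and i: "i \<in> {1..n+1}" for u i
  proof -
    have "(spatial_norm u)\<^sup>2 \<le> \<bar>K\<bar> + (u (n+1))\<^sup>2" using u(1) by (simp add: lor_self)
    also have "\<dots> \<le> (k + \<bar>u (n+1)\<bar>)\<^sup>2" by (simp add: power2_sum k)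
    finally have space: "spatial_norm u \<le> k + \<bar>u (n+1)\<bar>"
      by (rule power2_le_imp_le) (simp add: k)
    have "\<bar>u (n+1) * v (n+1)\<bar> \<le> \<bar>\<Sum>i=1..n. u i * v i\<bar> + C"
      using u(2) unfolding lor_def by linarith
    hence "\<bar>u (n+1)\<bar> * t \<le> \<bar>\<Sum>i=1..n. u i * v i\<bar> + C" by (simp add: t_def abs_mult)
    also have "\<dots> \<le> (k + \<bar>u (n+1)\<bar>) * s + C"
      using spatial_product_le[of u v] mult_right_mono[OF space st(1)] by (simp add: s_def)
    finally have "\<bar>u (n+1)\<bar> * (t - s) \<le> s * k + C" by (simp add: algebra_simps)
    hence time: "\<bar>u (n+1)\<bar> \<le> M" using st by (simp add: M_def pos_le_divide_eq)
    show ?thesis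
    proof (cases "i = n+1")
      case False
      have "\<bar>u i\<bar> \<le> spatial_norm u"
        using False i member_le_sum[of i "{1..n}" "\<lambda>i. (u i)\<^sup>2"]
        by (auto simp: L2_set_def intro!: real_le_rsqrt)
      thus ?thesis using space time by linarith
    qed (use time k(1) in simp)
  qed
  thus ?thesis by blast
qed

lemma finite_bounded_int_vecs:
  assumes "\<langle>v, v\<rangle> < 0" shows "finite {u. int_vec u \<and> \<langle>u, u\<rangle> \<le> K \<and> \<bar>\<langle>u, v\<rangle>\<bar> \<le> C}"
proof -
  obtain L where L: "\<And>u i. \<langle>u, u\<rangle> \<le> K \<Longrightarrow> \<bar>\<langle>u, v\<rangle>\<bar> \<le> C \<Longrightarrow> i \<in> {1..n+1} \<Longrightarrow> \<bar>u i\<bar> \<le> L"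
    using timelike_coordinate_bound[OF assms, of K C] by blast
  define B :: "real set" where "B = {x \<in> \<int>. \<bar>x\<bar> \<le> L}"
  have "{u. int_vec u \<and> \<langle>u, u\<rangle> \<le> K \<and> \<bar>\<langle>u, v\<rangle>\<bar> \<le> C}
      \<subseteq> {u. \<forall>i. (i \<in> {1..n+1} \<longrightarrow> u i \<in> B) \<and> (i \<notin> {1..n+1} \<longrightarrow> u i = 0)}"
  proof (intro subsetI CollectI allI conjI impI)
    fix u i assume "u \<in> {u. int_vec u \<and> \<langle>u, u\<rangle> \<le> K \<and> \<bar>\<langle>u, v\<rangle>\<bar> \<le> C}"
    hence u: "int_vec u" "\<langle>u, u\<rangle> \<le> K" "\<bar>\<langle>u, v\<rangle>\<bar> \<le> C" by simp_all
    show "u i \<in> B" if "i \<in> {1..n+1}"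
      using L[OF u(2,3) that] int_vec_Ints[OF u(1)] by (simp add: B_def)
    show "u i = 0" if "i \<notin> {1..n+1}"
      using int_vec_is_vec[OF u(1)] that unfolding is_vec_def by blast
  qed
  moreover have "finite \<dots>"
    unfolding B_def by (intro finite_set_of_finite_funs finite_abs_int_segment) simp
  ultimately show ?thesis by (rule finite_subset)
qed

definition Gamma_stabilizer :: "(nat \<Rightarrow> real) \<Rightarrow> (nat \<Rightarrow> nat \<Rightarrow> real) set" where
  "Gamma_stabilizer v = {A \<in> Gamma n. A *v v = v}"

lemma Gamma_stabilizerD:
  "A \<in> Gamma_stabilizer v \<Longrightarrow> A \<in> Gamma n" "A \<in> Gamma_stabilizer v \<Longrightarrow> A *v v = v"
  by (simp_all add: Gamma_stabilizer_def)

lemma Gamma_stabilizer_group: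
  assumes "is_vec n v" shows "lorentzian_group (Gamma_stabilizer v)"
proof -
  note G = lorentzian_groupD[OF Gamma_group]
  show ?thesis
    unfolding lorentzian_group_def
  proof (intro conjI ballI)
    show "idm n \<in> Gamma_stabilizer v" using G(1) assms by (simp add: Gamma_stabilizer_def)
  next
    fix A assume "A \<in> Gamma_stabilizer v"
    note A = Gamma_stabilizerD[OF this]
    show "lorentzian n A" using A(1) by simp
    have "adj A *v v = v" using mat_vec_adj_cancel(1)[of A v] A assms by simp
    thus "adj A \<in> Gamma_stabilizer v" using G(3)[OF A(1)] by (simp add: Gamma_stabilizer_def)
  next
    fix A B assume "A \<in> Gamma_stabilizer v" "B \<in> Gamma_stabilizer v"
    thus "A ** B \<in> Gamma_stabilizer v" using G(4)[of A B] by (simp add: Gamma_stabilizer_def)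
  qed
qed

lemma lor_stabilizer:
  assumes "A \<in> Gamma_stabilizer v" "is_vec n v" "is_vec n x" shows "\<langle>A *v x, v\<rangle> = \<langle>x, v\<rangle>"
  using lorentzian_lor[OF Gamma_lorentzian[OF Gamma_stabilizerD(1)[OF assms(1)]] assms(3,2)]
  by (simp add: Gamma_stabilizerD(2)[OF assms(1)])

lemma finite_stabilizer_orbit:
  assumes v: "\<langle>v, v\<rangle> < 0" "is_vec n v" and u: "int_vec u"
  shows "finite ((\<lambda>A. A *v u) ` Gamma_stabilizer v)"
proof -
  have "A *v u \<in> {w. int_vec w \<and> \<langle>w, w\<rangle> \<le> \<langle>u, u\<rangle> \<and> \<bar>\<langle>w, v\<rangle>\<bar> \<le> \<bar>\<langle>u, v\<rangle>\<bar>}"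
    if A: "A \<in> Gamma_stabilizer v" for A
    using Gamma_stabilizerD(1)[OF A] lor_stabilizer[OF A v(2), of u] u
    by (simp add: Gamma_int_vec lorentzian_lor)
  hence "(\<lambda>A. A *v u) ` Gamma_stabilizer v
      \<subseteq> {w. int_vec w \<and> \<langle>w, w\<rangle> \<le> \<langle>u, u\<rangle> \<and> \<bar>\<langle>w, v\<rangle>\<bar> \<le> \<bar>\<langle>u, v\<rangle>\<bar>}"
    by (rule image_subsetI)
  thus ?thesis by (rule finite_subset) (rule finite_bounded_int_vecs[OF v(1)])
qed

section \<open>The characteristic vector and the exceptional vectors\<close>

definition int_unit :: "(nat \<Rightarrow> real) \<Rightarrow> bool" where
  "int_unit r \<longleftrightarrow> int_vec r \<and> \<langle>r, r\<rangle> = 1"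

lemma int_unitD:
  assumes "int_unit r" shows "int_vec r" "is_vec n r" "\<langle>r, r\<rangle> = 1"
  using assms by (simp_all add: int_unit_def)

lemma int_unit_minus: "int_unit r \<Longrightarrow> int_unit (- r)"
  by (auto simp: int_unit_def)

lemma int_unit_mat_vec:
  assumes "A \<in> Gamma n" "int_unit r" shows "int_unit (A *v r)"
  using assms by (simp add: int_unit_def Gamma_int_vec lorentzian_lor)

lemma int_unit_reflect:
  assumes "int_unit w" "int_unit r" shows "int_unit (reflect w r)"
  using assms by (simp add: int_unit_def int_vec_reflect lor_reflect)

definition kappa :: "nat \<Rightarrow> real" where
  "kappa = (\<lambda>i. if i \<in> {1..n} then 1 else if i = n+1 then 3 else 0)"

definition exceptional :: "(nat \<Rightarrow> real) set" where
  "exceptional = {e. int_unit e \<and> \<langle>e, kappa\<rangle> = -1}"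

text \<open>The form is the negative of the intersection form of a del Pezzo surface, so being nef means
  pairing nonpositively with the exceptional vectors.\<close>
abbreviation nef :: "(nat \<Rightarrow> real) set" where
  "nef \<equiv> polar_cone exceptional"

abbreviation ample :: "(nat \<Rightarrow> real) set" where
  "ample \<equiv> open_polar_cone exceptional"

lemma int_vec_kappa [simp, intro]: "int_vec kappa"
  by (auto simp: int_vec_def is_vec_def kappa_def)

lemma is_vec_kappa [simp]: "is_vec n kappa"
  by (rule int_vec_is_vec) (rule int_vec_kappa)

lemma kappa_future: "kappa (n+1) > 0"
  by (simp add: kappa_def)

lemma lor_kappa: "\<langle>x, kappa\<rangle> = (\<Sum>i=1..n. x i) - 3 * x (n+1)"
proof -
  have "(\<Sum>i=1..n. x i * kappa i) = (\<Sum>i=1..n. x i)"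
    by (intro sum.cong) (auto simp: kappa_def)
  thus ?thesis by (simp add: lor_def kappa_def)
qed

lemma lor_kappa_kappa [simp]: "\<langle>kappa, kappa\<rangle> = real n - 9"
proof -
  have "(\<Sum>i=1..n. kappa i) = (\<Sum>i=1..n. 1)"
    by (intro sum.cong) (auto simp: kappa_def)
  thus ?thesis by (simp add: lor_kappa) (simp add: kappa_def)
qed

lemma kappa_characteristic:
  assumes u: "int_vec u" shows "[\<langle>u, u\<rangle> = \<langle>u, kappa\<rangle>] (rmod 2)"
proof (rule rcong_trans)
  show "[\<langle>u, u\<rangle> = (\<Sum>i=1..n. u i) - u (n+1)] (rmod 2)"
    unfolding lor_def by (intro rcong_diff rcong_sum rcong_2_square int_vec_Ints[OF u])
  show "[(\<Sum>i=1..n. u i) - u (n+1) = \<langle>u, kappa\<rangle>] (rmod 2)"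
    using int_vec_Ints[OF u] by (simp add: rcong_2_iff lor_kappa)
qed

lemma int_unit_kappa_odd: "int_unit r \<Longrightarrow> [\<langle>r, kappa\<rangle> = 1] (rmod 2)"
  using kappa_characteristic[of r] by (simp add: int_unit_def rcong_sym_iff)

lemma exceptionalD:
  assumes "e \<in> exceptional"
  shows "int_unit e" "int_vec e" "is_vec n e" "\<langle>e, e\<rangle> = 1" "\<langle>e, kappa\<rangle> = -1" "\<langle>kappa, e\<rangle> = -1"
  using assms by (simp_all add: exceptional_def int_unit_def lor_commute[of kappa e])

lemma kappa_ample: "kappa \<in> ample"
  by (simp add: open_polar_cone_def exceptionalD)

lemma exceptional_coordinate_sums:
  assumes "e \<in> exceptional"
  shows "(\<Sum>i=1..n. e i) = 3 * e (n+1) - 1" "(\<Sum>i=1..n. e i * e i) = e (n+1) * e (n+1) + 1"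
  using exceptionalD(4,5)[OF assms] lor_kappa[of e] by (simp_all add: lor_def[of n e e])

lemma neg_unit_vec_exceptional:
  assumes "i \<in> {1..n}" shows "- unit_vec i \<in> exceptional"
proof -
  have "int_vec (- unit_vec i)" using assms by (intro int_vec_minus int_vec_unit_vec) auto
  moreover have "\<langle>unit_vec i, unit_vec i\<rangle> = 1" "\<langle>kappa, unit_vec i\<rangle> = 1"
    using assms by (simp_all add: lor_space_unit_vec) (simp_all add: unit_vec_def kappa_def)
  ultimately show ?thesis
    by (simp add: exceptional_def int_unit_def lor_commute[of "unit_vec i" kappa])
qed

definition pair_vec :: "nat \<Rightarrow> real" where
  "pair_vec = unit_vec 1 + unit_vec 2 + unit_vec (n+1)"

lemma lor_pair_vec:
  assumes "2 \<le> n" shows "\<langle>x, pair_vec\<rangle> = x 1 + x 2 - x (n+1)"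
  using assms lor_time_unit_vec[of x] by (simp add: pair_vec_def lor_space_unit_vec)

lemma pair_vec_exceptional:
  assumes "2 \<le> n" shows "pair_vec \<in> exceptional"
proof -
  have "int_vec pair_vec" unfolding pair_vec_def using assms
    by (intro int_vec_add int_vec_unit_vec) auto
  moreover have "\<langle>pair_vec, pair_vec\<rangle> = 1" "\<langle>kappa, pair_vec\<rangle> = -1"
    using assms by (simp_all add: lor_pair_vec) (simp_all add: pair_vec_def kappa_def unit_vec_def)
  ultimately show ?thesis by (simp add: exceptional_def int_unit_def lor_commute[of pair_vec kappa])
qed

lemma orthogonal_exceptional_imp_0:
  assumes n: "2 \<le> n" and x: "is_vec n x" and orth: "\<And>e. e \<in> exceptional \<Longrightarrow> \<langle>x, e\<rangle> = 0"
  shows "x = 0"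
proof (rule is_vec_eqI)
  show space: "x i = 0 i" if "i \<in> {1..n}" for i
    using orth[OF neg_unit_vec_exceptional[OF that]] that by (simp add: lor_space_unit_vec)
  show "x (n+1) = 0 (n+1)"
    using orth[OF pair_vec_exceptional[OF n]] space[of 1] space[of 2] n by (simp add: lor_pair_vec)
qed (use x in \<open>simp_all add: is_vec_def\<close>)

lemma fixes_exceptional_imp_idm:
  assumes n: "2 \<le> n" and A: "lorentzian n A" and fixed: "\<And>e. e \<in> exceptional \<Longrightarrow> A *v e = e"
  shows "A = idm n"
proof (rule mat_eqI)
  fix x assume x: "is_vec n x"
  have "A *v x - x = 0"
  proof (rule orthogonal_exceptional_imp_0[OF n])
    fix e assume e: "e \<in> exceptional"
    show "\<langle>A *v x - x, e\<rangle> = 0"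
      using lorentzian_lor[OF A x exceptionalD(3)[OF e]] fixed[OF e] by simp
  qed (use x in simp)
  thus "A *v x = idm n *v x" using x by simp
qed (use A in \<open>simp_all add: lorentzian_is_mat\<close>)

lemma lor_reflect_unit:
  assumes "\<langle>e, e\<rangle> = 1" shows "\<langle>reflect e x, y\<rangle> = \<langle>x, y\<rangle> - 2 * \<langle>x, e\<rangle> * \<langle>e, y\<rangle>"
  using assms by (simp add: reflect_def)

lemma exceptional_reflection_decreases_degree:
  assumes e: "e \<in> exceptional" and u: "int_vec u" "\<langle>u, e\<rangle> > 0" and neg: "\<langle>reflect e u, kappa\<rangle> < 0"
  shows "nat \<lfloor>- \<langle>reflect e u, kappa\<rangle>\<rfloor> < nat \<lfloor>- \<langle>u, kappa\<rangle>\<rfloor>"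
proof -
  note E = exceptionalD[OF e]
  have "\<langle>u, e\<rangle> \<in> \<int>" using u(1) E(2) by (rule lor_Ints)
  hence "0 + 1 \<le> \<langle>u, e\<rangle>" using u(2) by (intro Ints_less_imp_add1_le) auto
  moreover have "\<langle>reflect e u, kappa\<rangle> = \<langle>u, kappa\<rangle> + 2 * \<langle>u, e\<rangle>"
    using E(4,5) by (simp add: lor_reflect_unit)
  ultimately show ?thesis using neg by linarith
qed

section \<open>The simplicial cone over the simplex\<close>

text \<open>The minimum absorbs the special form of \<open>\<Delta>\<^sup>2\<close>.\<close>
definition height :: "(nat \<Rightarrow> real) \<Rightarrow> real" where
  "height x = x (n+1) - (\<Sum>i=1..min n 3. x i)"

definition simplex_cone :: "(nat \<Rightarrow> real) set" where
  "simplex_cone = {x. is_vec n x \<and> (\<forall>i\<in>{1..<n}. x (i+1) \<le> x i) \<and> 0 \<le> x n \<and> 0 \<le> height x}"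

definition simplex_vertex :: "nat \<Rightarrow> nat \<Rightarrow> real" where
  "simplex_vertex k = (if k = 0 then unit_vec (n+1)
     else (\<lambda>i. if i \<in> {1..k} then 1 else if i = n+1 then real (min k 3) else 0))"

definition simplex_coeff :: "(nat \<Rightarrow> real) \<Rightarrow> nat \<Rightarrow> real" where
  "simplex_coeff x k = (if k = 0 then height x else x k - (if k < n then x (k+1) else 0))"

lemma Delta_eq:
  assumes "2 \<le> n" shows "Delta n = hyp n \<inter> simplex_cone"
proof (cases "n = 2")
  case True
  thus ?thesis
    unfolding Delta_def simplex_cone_def height_def
    by (auto simp: hyp_def numeral_2_eq_2 numeral_3_eq_3 atLeastLessThanSuc)
next
  case False
  hence "min n 3 = 3" using assms by simp
  moreover have "(\<Sum>i=1..3. x i) = x 1 + x 2 + x 3" for x :: "nat \<Rightarrow> real"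
    by (simp add: numeral_3_eq_3 numeral_2_eq_2)
  ultimately show ?thesis
    using False by (auto simp: Delta_def simplex_cone_def height_def hyp_def)
qed

lemma linear_height: "linear height"
  by (rule linearI) (simp_all add: height_def sum.distrib sum_distrib_left algebra_simps)

lemma simplex_coeff_nonneg:
  assumes "x \<in> simplex_cone" "k \<le> n" shows "0 \<le> simplex_coeff x k"
proof -
  consider "k = 0" | "k \<in> {1..<n}" | "k = n" "k \<noteq> 0" using assms(2) by fastforce
  thus ?thesis
    using assms(1) by cases (auto simp: simplex_cone_def simplex_coeff_def)
qed

lemma int_vec_simplex_vertex:
  assumes "k \<le> n" shows "int_vec (simplex_vertex k)"
  using assms by (auto simp: int_vec_def is_vec_def simplex_vertex_def unit_vec_def)

lemma height_simplex_vertex: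
  assumes "k \<le> n" shows "height (simplex_vertex k) = (if k = 0 then 1 else 0)"
proof (cases "k = 0")
  case True
  have "(\<Sum>i=1..min n 3. unit_vec (n+1) i) = 0" by (intro sum.neutral) (auto simp: unit_vec_def)
  thus ?thesis using True by (simp add: height_def simplex_vertex_def) (simp add: unit_vec_def)
next
  case False
  have "(\<Sum>i=1..min n 3. simplex_vertex k i) = (\<Sum>i\<in>{1..min n 3}. if i \<in> {1..k} then 1 else 0)"
    using False by (intro sum.cong) (auto simp: simplex_vertex_def)
  also have "\<dots> = real (card ({1..min n 3} \<inter> {1..k}))"
    by (subst sum.inter_restrict[symmetric]) auto
  also have "\<dots> = real (min k 3)" using assms by simp
  finally show ?thesis using False assms by (simp add: height_def) (simp add: simplex_vertex_def)
qed

lemma simplex_combination_coordinate: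
  assumes j: "j \<in> {1..n}"
  shows "(\<Sum>k=0..n. simplex_coeff x k * simplex_vertex k j) = x j"
proof -
  define y where "y k = (if k \<le> n then x k else 0)" for k
  have "(\<Sum>k=0..n. simplex_coeff x k * simplex_vertex k j)
      = (\<Sum>k=0..n. if k \<in> {j..n} then y k - y (Suc k) else 0)"
    using j by (intro sum.cong) (auto simp: simplex_vertex_def simplex_coeff_def y_def unit_vec_def)
  also have "\<dots> = (\<Sum>k\<in>{0..n} \<inter> {j..n}. y k - y (Suc k))"
    by (subst sum.inter_restrict) auto
  also have "{0..n} \<inter> {j..n} = {j..n}" using j by auto
  also have "(\<Sum>k\<in>{j..n}. y k - y (Suc k)) = y j - y (Suc n)"
    using j sum_Suc_diff[of j n "\<lambda>k. - y k"] by simp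
  finally show ?thesis using j by (simp add: y_def)
qed

lemma simplex_decomposition:
  assumes x: "is_vec n x"
  shows "x = (\<Sum>k=0..n. simplex_coeff x k *\<^sub>R simplex_vertex k)" (is "x = ?s")
proof (rule is_vec_eqI)
  show space: "x i = ?s i" if "i \<in> {1..n}" for i
    by (simp add: sum_fun_apply simplex_combination_coordinate[OF that])
  have "height ?s = (\<Sum>k=0..n. simplex_coeff x k * height (simplex_vertex k))"
    by (simp add: linear_sum[OF linear_height] linear_scale[OF linear_height])
  also have "\<dots> = (\<Sum>k=0..n. if k = 0 then height x else 0)"
    by (intro sum.cong) (auto simp: height_simplex_vertex simplex_coeff_def)
  finally have "height ?s = height x" by simp
  moreover have "(\<Sum>i=1..min n 3. ?s i) = (\<Sum>i=1..min n 3. x i)"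
    by (intro sum.cong) (auto simp: space)
  ultimately show "x (n+1) = ?s (n+1)" by (simp add: height_def)
  show "is_vec n ?s"
    using int_vec_simplex_vertex
    by (auto simp: is_vec_def sum_fun_apply int_vec_def intro!: sum.neutral)
qed (rule x)

lemma lor_simplex_vertex:
  assumes "k \<le> n"
  shows "\<langle>simplex_vertex k, z\<rangle> =
    (if k = 0 then - z (n+1) else (\<Sum>i=1..k. z i) - real (min k 3) * z (n+1))"
proof (cases "k = 0")
  case True
  thus ?thesis
    using lor_time_unit_vec[of z] by (simp add: simplex_vertex_def lor_commute[of "unit_vec _" z])
next
  case False
  have "(\<Sum>i=1..n. simplex_vertex k i * z i) = (\<Sum>i\<in>{1..n}. if i \<in> {1..k} then z i else 0)"
    using False by (intro sum.cong) (auto simp: simplex_vertex_def)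
  also have "\<dots> = (\<Sum>i\<in>{1..n} \<inter> {1..k}. z i)"
    by (subst sum.inter_restrict) auto
  also have "{1..n} \<inter> {1..k} = {1..k}" using assms by auto
  finally show ?thesis using False assms by (simp add: lor_def) (simp add: simplex_vertex_def)
qed

lemma simplex_vertex_future: "k \<le> n \<Longrightarrow> 0 < simplex_vertex k (n+1)"
  by (simp add: simplex_vertex_def unit_vec_def)

lemma lor_simplex_cone_nonpos:
  assumes x: "x \<in> simplex_cone" and z: "\<And>k. k \<le> n \<Longrightarrow> \<langle>simplex_vertex k, z\<rangle> \<le> 0"
  shows "\<langle>x, z\<rangle> \<le> 0"
proof -
  have "is_vec n x" using x by (simp add: simplex_cone_def)
  hence "\<langle>x, z\<rangle> = \<langle>\<Sum>k=0..n. simplex_coeff x k *\<^sub>R simplex_vertex k, z\<rangle>"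
    using simplex_decomposition by metis
  also have "\<dots> = (\<Sum>k=0..n. simplex_coeff x k * \<langle>simplex_vertex k, z\<rangle>)"
    by (simp add: lor_sum_left)
  also have "\<dots> \<le> 0"
    using simplex_coeff_nonneg[OF x] z by (intro sum_nonpos mult_nonneg_nonpos) auto
  finally show ?thesis .
qed

section \<open>The simple roots\<close>

definition swap_root :: "nat \<Rightarrow> nat \<Rightarrow> real" where
  "swap_root i = unit_vec (i+1) - unit_vec i"

definition triple_root :: "nat \<Rightarrow> real" where
  "triple_root = (\<lambda>i. unit_vec 1 i + unit_vec 2 i + unit_vec 3 i + unit_vec (n+1) i)"

definition simple_roots :: "(nat \<Rightarrow> real) set" where
  "simple_roots = swap_root ` {1..<n} \<union> (if n = 2 then {} else {triple_root})"

lemma triple_root_eq: "triple_root = unit_vec 1 + unit_vec 2 + unit_vec 3 + unit_vec (n+1)"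
  by (simp add: triple_root_def fun_eq_iff)

lemma lor_swap_root:
  assumes "i \<in> {1..<n}" shows "\<langle>x, swap_root i\<rangle> = x (i+1) - x i"
  using assms lor_space_unit_vec[of "i+1" x] by (simp add: swap_root_def lor_space_unit_vec)

lemma lor_triple_root:
  assumes "3 \<le> n" shows "\<langle>x, triple_root\<rangle> = x 1 + x 2 + x 3 - x (n+1)"
  using assms lor_time_unit_vec[of x] by (simp add: triple_root_eq lor_space_unit_vec)

lemma swap_root_norm: "i \<in> {1..<n} \<Longrightarrow> \<langle>swap_root i, swap_root i\<rangle> = 2"
  by (simp add: lor_swap_root) (simp add: swap_root_def unit_vec_def)

lemma triple_root_norm: "3 \<le> n \<Longrightarrow> \<langle>triple_root, triple_root\<rangle> = 2"
  by (simp add: lor_triple_root) (simp add: triple_root_def unit_vec_def)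

lemma swap_mat_eq_hrefl:
  assumes "i \<in> {1..<n}" shows "swap_mat n i = hrefl n (swap_root i)"
proof (intro ext)
  fix a b
  show "swap_mat n i a b = hrefl n (swap_root i) a b"
    unfolding hrefl_def swap_root_norm[OF assms] using assms
    by (cases "a = i"; cases "a = i+1"; cases "b = i"; cases "b = i+1")
      (auto simp: swap_mat_def lin_refl_def idm_def swap_root_def unit_vec_def)
qed

lemma Sigma_gens_eq:
  assumes "2 \<le> n" shows "Sigma_gens n = hrefl n ` simple_roots"
proof -
  have swaps: "{swap_mat n i | i. 1 \<le> i \<and> i \<le> n - 1} = hrefl n ` swap_root ` {1..<n}"
  proof -
    have "{i. 1 \<le> i \<and> i \<le> n - 1} = {1..<n}" using assms by auto
    hence "{swap_mat n i | i. 1 \<le> i \<and> i \<le> n - 1} = swap_mat n ` {1..<n}"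
      by (simp only: setcompr_eq_image)
    also have "\<dots> = hrefl n ` swap_root ` {1..<n}"
      unfolding image_image by (intro image_cong refl swap_mat_eq_hrefl)
    finally show ?thesis .
  qed
  show ?thesis
  proof (cases "n = 2")
    case True
    hence "{swap_mat n i | i. 1 \<le> i \<and> i \<le> n - 1} = {swap_mat n 1}"
      by (auto intro: le_antisym)
    thus ?thesis using True swaps unfolding Sigma_gens_def simple_roots_def by simp
  next
    case False
    hence "lin_refl n 1 triple_root = hrefl n triple_root"
      using assms by (simp add: hrefl_def triple_root_norm)
    thus ?thesis
      using False swaps unfolding Sigma_gens_def simple_roots_def triple_root_def
      by (simp only: if_False image_Un image_insert image_empty)
  qed
qed

lemma simple_rootD:
  assumes n: "2 \<le> n" and w: "w \<in> simple_roots"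
  shows "int_vec w" "\<langle>w, w\<rangle> = 2" "\<langle>kappa, w\<rangle> = 0"
proof -
  consider i where "w = swap_root i" "i \<in> {1..<n}" | "w = triple_root" "3 \<le> n"
    using w n by (auto simp: simple_roots_def split: if_splits)
  hence "int_vec w \<and> \<langle>w, w\<rangle> = 2 \<and> \<langle>kappa, w\<rangle> = 0"
  proof cases
    case 1
    have "int_vec w" unfolding 1(1) swap_root_def using 1(2)
      by (intro int_vec_diff int_vec_unit_vec) auto
    moreover have "\<langle>kappa, w\<rangle> = 0" using 1 by (simp add: lor_swap_root) (simp add: kappa_def)
    ultimately show ?thesis using 1 by (simp add: swap_root_norm)
  next
    case 2
    have "int_vec w" unfolding 2(1) triple_root_eq using 2(2)
      by (intro int_vec_add int_vec_unit_vec) auto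
    moreover have "\<langle>kappa, w\<rangle> = 0" using 2 by (simp add: lor_triple_root) (simp add: kappa_def)
    ultimately show ?thesis using 2 by (simp add: triple_root_norm)
  qed
  thus "int_vec w" "\<langle>w, w\<rangle> = 2" "\<langle>kappa, w\<rangle> = 0" by blast+
qed

text \<open>Any integral vector strictly inside the chamber of the simple roots would do.\<close>
definition rho :: "nat \<Rightarrow> real" where
  "rho = (\<lambda>i. if i \<in> {1..n} then real (n + 1 - i) else if i = n+1 then 3 * real n else 0)"

lemma int_vec_rho: "int_vec rho"
  by (auto simp: int_vec_def is_vec_def rho_def)

lemma rho_open_chamber:
  assumes "2 \<le> n" shows "rho \<in> open_polar_cone simple_roots"
proof -
  have "\<langle>rho, swap_root i\<rangle> < 0" if "i \<in> {1..<n}" for i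
    using that by (simp add: lor_swap_root) (simp add: rho_def)
  moreover have "\<langle>rho, triple_root\<rangle> < 0" if "3 \<le> n"
    using that by (simp add: lor_triple_root) (simp add: rho_def)
  ultimately show ?thesis
    using assms int_vec_rho by (auto simp: open_polar_cone_def simple_roots_def)
qed

lemma hrefl_simple_root_stabilizer:
  assumes "2 \<le> n" "w \<in> simple_roots" shows "hrefl n w \<in> Gamma_stabilizer kappa"
proof -
  note W = simple_rootD[OF assms]
  have "hrefl n w *v kappa = kappa" using W by (simp add: mat_vec_hrefl reflect_def)
  thus ?thesis using Gamma_hrefl[of w] W by (simp add: Gamma_stabilizer_def)
qed

lemma Sigma_gens_subset_stabilizer: "2 \<le> n \<Longrightarrow> Sigma_gens n \<subseteq> Gamma_stabilizer kappa"
  by (auto simp: Sigma_gens_eq hrefl_simple_root_stabilizer)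

lemma SigmaG_group: "2 \<le> n \<Longrightarrow> lorentzian_group (SigmaG n)"
  unfolding SigmaG_def
  by (rule lorentzian_group_gen_grp[OF Gamma_stabilizer_group[OF is_vec_kappa]
        Sigma_gens_subset_stabilizer])

lemma SigmaG_subset_stabilizer: "2 \<le> n \<Longrightarrow> SigmaG n \<subseteq> Gamma_stabilizer kappa"
  unfolding SigmaG_def
  by (rule gen_grp_subset[OF Gamma_stabilizer_group[OF is_vec_kappa] Sigma_gens_subset_stabilizer])

lemma exceptional_stabilizer:
  assumes "A \<in> Gamma_stabilizer kappa" "e \<in> exceptional" shows "A *v e \<in> exceptional"
  using int_unit_mat_vec[OF Gamma_stabilizerD(1)[OF assms(1)] exceptionalD(1)[OF assms(2)]]
    lor_stabilizer[OF assms(1) is_vec_kappa exceptionalD(3)[OF assms(2)]]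
    exceptionalD(5)[OF assms(2)]
  by (simp add: exceptional_def)

lemma nef_stabilizer:
  assumes A: "A \<in> Gamma_stabilizer kappa" and x: "x \<in> nef" shows "A *v x \<in> nef"
proof -
  have "adj A \<in> Gamma_stabilizer kappa"
    using lorentzian_groupD(3)[OF Gamma_stabilizer_group[OF is_vec_kappa]] A .
  thus ?thesis
    using x exceptional_stabilizer[of "adj A"] by (simp add: polar_cone_def lor_mat_vec_left)
qed

end

locale congruence_two = lorentzian_space +
  assumes dim_ge: "2 \<le> n" and dim_le: "n \<le> 7"
begin

section \<open>Exceptional vectors in dimension at most seven\<close>

lemma kappa_timelike: "\<langle>kappa, kappa\<rangle> < 0"
  using dim_le by simp

lemma finite_exceptional: "finite exceptional"
  by (rule finite_subset[OF _ finite_bounded_int_vecs[OF kappa_timelike, of 1 1]])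
    (auto simp: exceptional_def int_unit_def)

lemma exceptional_Cauchy_Schwarz:
  assumes e: "e \<in> exceptional" and r: "is_vec n r"
  shows "((9 - real n) * \<langle>r, e\<rangle> - \<langle>r, kappa\<rangle>)\<^sup>2
       \<le> (10 - real n) * (\<langle>r, kappa\<rangle>\<^sup>2 + (9 - real n) * \<langle>r, r\<rangle>)"
  using lor_Cauchy_Schwarz_projected[OF kappa_timelike is_vec_kappa r exceptionalD(3)[OF e]]
  by (simp add: exceptionalD[OF e] power2_eq_square algebra_simps)

lemma lor_exceptional_less_1:
  assumes "e \<in> exceptional" "f \<in> exceptional" "e \<noteq> f" shows "\<langle>e, f\<rangle> < 1"
proof -
  note E = exceptionalD[OF assms(1)] and F = exceptionalD[OF assms(2)]
  have "0 < \<langle>e - f, e - f\<rangle>"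
    using E F assms(3) by (intro timelike_orthogonal_pos[OF kappa_timelike]) auto
  thus ?thesis by (simp add: E F lor_commute[of f e])
qed

lemma lor_exceptional_ge:
  assumes e: "e \<in> exceptional" and f: "f \<in> exceptional" shows "-2 \<le> \<langle>e, f\<rangle>"
proof (rule ccontr)
  define N where "N = 9 - real n"
  have N: "2 \<le> N" using dim_le by (simp add: N_def)
  assume "\<not> -2 \<le> \<langle>e, f\<rangle>"
  hence "N * \<langle>e, f\<rangle> < N * (-2)" using N by (intro mult_strict_left_mono) auto
  moreover have "(N * \<langle>e, f\<rangle> + 1)\<^sup>2 \<le> (N + 1)\<^sup>2"
    using exceptional_Cauchy_Schwarz[OF f exceptionalD(3)[OF e]]
    by (simp add: N_def exceptionalD[OF e] power2_eq_square)
  hence "\<bar>N * \<langle>e, f\<rangle> + 1\<bar> \<le> \<bar>N + 1\<bar>" unfolding abs_le_square_iff .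
  ultimately show False using N by linarith
qed

text \<open>If \<open>e \<noteq> f\<close> were congruent, \<open>(e - f) / 2\<close> would be an integral vector orthogonal to
  \<open>kappa\<close>, hence of even norm, but its norm \<open>(1 - \<langle>e, f\<rangle>) / 2\<close> lies strictly between 0 and 2.\<close>
lemma exceptional_rcong_imp_eq:
  assumes e: "e \<in> exceptional" and f: "f \<in> exceptional" and cong: "\<And>i. [e i = f i] (rmod 2)"
  shows "e = f"
proof (rule ccontr)
  assume "e \<noteq> f"
  note E = exceptionalD[OF e] and F = exceptionalD[OF f]
  define u where "u = (1/2) *\<^sub>R (e - f)"
  have "is_vec n u" using E(3) F(3) by (simp add: u_def)
  moreover have "u i \<in> \<int>" for i using cong[of i] by (simp add: u_def rcong_2_iff)
  ultimately have "int_vec u" by (simp add: int_vec_def)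
  moreover have "\<langle>u, kappa\<rangle> = 0" by (simp add: u_def E(5) F(5))
  ultimately have "\<langle>u, u\<rangle> / 2 \<in> \<int>" using kappa_characteristic[of u] by (simp add: rcong_2_iff)
  moreover have "\<langle>u, u\<rangle> / 2 = (1 - \<langle>e, f\<rangle>) / 4"
    by (simp add: u_def E(4) F(4) lor_commute[of f e] field_simps)
  moreover have "-2 \<le> \<langle>e, f\<rangle>" "\<langle>e, f\<rangle> < 1"
    using lor_exceptional_ge[OF e f] lor_exceptional_less_1[OF e f \<open>e \<noteq> f\<close>] by simp_all
  ultimately show False
    using Ints_nonzero_abs_ge1[of "(1 - \<langle>e, f\<rangle>) / 4"] by simp
qed

lemma lor_exceptional_less_half_degree:
  assumes e: "e \<in> exceptional" and r: "int_unit r" "\<langle>r, kappa\<rangle> \<le> -3"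
  shows "2 * \<langle>r, e\<rangle> < - \<langle>r, kappa\<rangle>"
proof (rule ccontr)
  define N m b where "N = 9 - real n" and "m = - \<langle>r, kappa\<rangle>" and "b = \<langle>r, e\<rangle>"
  assume "\<not> 2 * \<langle>r, e\<rangle> < - \<langle>r, kappa\<rangle>"
  hence b: "m \<le> 2 * b" by (simp add: m_def b_def)
  have N: "2 \<le> N" using dim_le by (simp add: N_def)
  have m: "3 \<le> m" using r by (simp add: m_def)
  have cs: "(N * b + m)\<^sup>2 \<le> (N + 1) * (m\<^sup>2 + N)"
    using exceptional_Cauchy_Schwarz[OF e int_unitD(2)[OF r(1)]] int_unitD(3)[OF r(1)]
    by (simp add: N_def m_def b_def)
  have "N * m \<le> N * (2 * b)" using b N by (intro mult_left_mono) auto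
  hence "(N + 2) * m \<le> 2 * (N * b + m)" by (simp add: algebra_simps)
  hence "((N + 2) * m)\<^sup>2 \<le> (2 * (N * b + m))\<^sup>2"
    using N m by (intro power_mono) auto
  also have "\<dots> = 4 * (N * b + m)\<^sup>2" by (simp only: power_mult_distrib) simp
  also have "\<dots> \<le> 4 * ((N + 1) * (m\<^sup>2 + N))" using cs by simp
  finally have "N * (N * m\<^sup>2) \<le> N * (4 * N + 4)"
    by (simp add: power2_eq_square algebra_simps)
  hence "N * m\<^sup>2 \<le> 4 * N + 4" using N by simp
  moreover have "N * 9 \<le> N * m\<^sup>2" using power_mono[OF m, of 2] N by (intro mult_left_mono) auto
  ultimately show False using N by linarith
qed

lemma exceptional_time_bounds:
  assumes e: "e \<in> exceptional"
  shows "0 \<le> e (n+1)" "e (n+1) \<le> 3"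
proof -
  define d where "d = e (n+1)"
  have d: "d \<in> \<int>" using exceptionalD(2)[OF e] by (auto simp: d_def)
  have "(\<Sum>i=1..n. e i * kappa i) = 3 * d - 1"
    using exceptional_coordinate_sums(1)[OF e] lor_kappa[of e]
    by (simp add: lor_def d_def kappa_def)
  hence "\<bar>3 * d - 1\<bar> \<le> \<bar>spatial_norm e * spatial_norm kappa\<bar>"
    using spatial_product_le[of e kappa] by simp
  hence "(3 * d - 1)\<^sup>2 \<le> (spatial_norm e)\<^sup>2 * (spatial_norm kappa)\<^sup>2"
    unfolding abs_le_square_iff power_mult_distrib .
  also have "(spatial_norm e)\<^sup>2 = d\<^sup>2 + 1" using exceptionalD(4)[OF e] by (simp add: lor_self d_def)
  also have "(spatial_norm kappa)\<^sup>2 = real n"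
    using lor_kappa_kappa by (simp add: lor_self kappa_def)
  also have "(d\<^sup>2 + 1) * real n \<le> (d\<^sup>2 + 1) * 7" using dim_le by (intro mult_left_mono) auto
  finally have quad: "d * d - 3 * d \<le> 3" by (simp add: power2_eq_square algebra_simps)
  have "0 \<le> d \<and> d \<le> 3"
  proof (rule ccontr)
    assume "\<not> (0 \<le> d \<and> d \<le> 3)"
    hence "d < 0 \<or> 3 < d" by linarith
    hence "d + 1 \<le> 0 \<or> 3 + 1 \<le> d"
      using Ints_less_imp_add1_le[OF d Ints_0] Ints_less_imp_add1_le[OF Ints_numeral d] by blast
    hence "0 \<le> (d + 1) * (d - 4)" by (auto simp: zero_le_mult_iff)
    thus False using quad by (simp add: algebra_simps)
  qed
  thus "0 \<le> e (n+1)" "e (n+1) \<le> 3" by (simp_all add: d_def)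
qed

lemma exceptional_coordinate_le:
  assumes e: "e \<in> exceptional" and i: "i \<in> {1..n}"
  shows "e i \<le> e (n+1)"
proof (rule ccontr)
  define d where "d = e (n+1)"
  assume "\<not> e i \<le> e (n+1)"
  have I: "e j \<in> \<int>" for j using exceptionalD(2)[OF e] by blast
  have d0: "0 \<le> d" using exceptional_time_bounds[OF e] by (simp add: d_def)
  have ge: "d + 1 \<le> e i"
    using \<open>\<not> e i \<le> e (n+1)\<close> by (intro Ints_less_imp_add1_le) (auto simp: I d_def)
  have "(d + 1) * (d + 1) \<le> e i * e i" using ge d0 by (intro mult_mono) auto
  also have "\<dots> \<le> (\<Sum>i=1..n. e i * e i)" using i by (intro member_le_sum) auto
  also have "\<dots> = d * d + 1" using exceptional_coordinate_sums(2)[OF e] by (simp add: d_def)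
  finally have d: "d = 0" using d0 by (simp add: algebra_simps)
  have "(\<Sum>i=1..n. e i * e i + e i) = 0"
    using exceptional_coordinate_sums[OF e] d by (simp add: sum.distrib d_def)
  moreover have "0 \<le> e j * e j + e j" for j using Ints_abs_le_square[OF I[of j]] by linarith
  hence "e i * e i + e i \<le> (\<Sum>i=1..n. e i * e i + e i)"
    using i by (intro member_le_sum) auto
  ultimately show False using ge d zero_le_square[of "e i"] by linarith
qed

text \<open>The integers \<open>e\<^sub>i\<^sup>2 - e\<^sub>i\<close> are nonnegative with sum \<open>(d - 1) * (d - 2) \<le> 2\<close> for
  \<open>d = e\<^sub>n\<^sub>+\<^sub>1\<close>, so the coordinates after \<open>k\<close> cannot sum to less than \<open>-1\<close>.\<close>
lemma exceptional_initial_sum_le: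
  assumes e: "e \<in> exceptional" and k: "k \<le> n"
  shows "(\<Sum>i=1..k. e i) \<le> 3 * e (n+1)"
proof -
  define d where "d = e (n+1)"
  have I: "e j \<in> \<int>" for j using exceptionalD(2)[OF e] by blast
  note S = exceptional_coordinate_sums[OF e, folded d_def]
  have "0 \<le> d" "d \<le> 3" using exceptional_time_bounds[OF e] by (simp_all add: d_def)
  hence "d * (d - 3) \<le> 0" by (intro mult_nonneg_nonpos) auto
  have split: "(\<Sum>i=1..n. f i) = (\<Sum>i=1..k. f i) + (\<Sum>i=Suc k..n. f i)" for f :: "nat \<Rightarrow> real"
    using sum.ub_add_nat[of 1 k f "n-k"] k by simp
  have "(\<Sum>i=Suc k..n. - 2 * e i) \<le> (\<Sum>i=Suc k..n. e i * e i - e i)"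
  proof (rule sum_mono)
    fix i show "- 2 * e i \<le> e i * e i - e i" using Ints_abs_le_square[OF I[of i]] by linarith
  qed
  also have "\<dots> \<le> (\<Sum>i=1..n. e i * e i - e i)"
  proof -
    have "0 \<le> e i * e i - e i" for i using Ints_abs_le_square[OF I[of i]] by linarith
    thus ?thesis unfolding split[of "\<lambda>i. e i * e i - e i"] by (simp add: sum_nonneg)
  qed
  also have "\<dots> = d * (d - 3) + 2" unfolding sum_subtractf S by (simp add: algebra_simps)
  finally have "- 2 * (\<Sum>i=Suc k..n. e i) \<le> 2"
    using \<open>d * (d - 3) \<le> 0\<close> unfolding sum_distrib_left[symmetric] by linarith
  thus ?thesis using S(1) split[of e] unfolding d_def by linarith
qed

lemma simplex_vertex_nef:
  assumes k: "k \<le> n" shows "simplex_vertex k \<in> nef"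
proof -
  have "\<langle>simplex_vertex k, e\<rangle> \<le> 0" if e: "e \<in> exceptional" for e
  proof -
    consider "k = 0" | "1 \<le> k" "k \<le> 3" | "k > 3" by linarith
    thus ?thesis
    proof cases
      case 1
      thus ?thesis using exceptional_time_bounds[OF e] by (simp add: lor_simplex_vertex)
    next
      case 2
      have "(\<Sum>i=1..k. e i) \<le> (\<Sum>i=1..k. e (n+1))"
        using exceptional_coordinate_le[OF e] k by (intro sum_mono) auto
      thus ?thesis using 2 k by (simp add: lor_simplex_vertex)
    next
      case 3
      thus ?thesis using exceptional_initial_sum_le[OF e k] k by (simp add: lor_simplex_vertex)
    qed
  qed
  thus ?thesis using int_vec_simplex_vertex[OF k] by (simp add: polar_cone_def)
qed

lemma simplex_vertex_nonspacelike:
  assumes k: "k \<le> n" shows "\<langle>simplex_vertex k, simplex_vertex k\<rangle> \<le> 0"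
proof (cases "k = 0")
  case True
  thus ?thesis using simplex_vertex_future[of 0] by (simp add: lor_simplex_vertex)
next
  case False
  have "(\<Sum>i=1..k. simplex_vertex k i) = (\<Sum>i=1..k. 1)"
    using False by (intro sum.cong) (auto simp: simplex_vertex_def)
  hence eq: "\<langle>simplex_vertex k, simplex_vertex k\<rangle> = real k - real (min k 3 * min k 3)"
    using k False by (simp add: lor_simplex_vertex) (simp add: simplex_vertex_def)
  have "k \<le> min k 3 * min k 3" using k dim_le by (cases "k \<le> 3") (simp_all add: min_def)
  hence "real k \<le> real (min k 3 * min k 3)" by (rule of_nat_mono)
  thus ?thesis using eq by linarith
qed

lemma simplex_cone_subset_nef: "simplex_cone \<subseteq> nef"
proof
  fix x assume x: "x \<in> simplex_cone"
  have "\<langle>x, e\<rangle> \<le> 0" if "e \<in> exceptional" for e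
    using simplex_vertex_nef that
    by (intro lor_simplex_cone_nonpos[OF x]) (auto simp: polar_cone_def)
  thus "x \<in> nef" using x by (simp add: polar_cone_def simplex_cone_def)
qed

lemma simplex_cone_nonspacelike:
  assumes x: "x \<in> simplex_cone" shows "\<langle>x, x\<rangle> \<le> 0"
proof (rule lor_simplex_cone_nonpos[OF x])
  fix k assume k: "k \<le> n"
  have "\<langle>simplex_vertex j, simplex_vertex k\<rangle> \<le> 0" if "j \<le> n" for j
    by (rule lor_causal_future_nonpos)
      (use that k simplex_vertex_nonspacelike simplex_vertex_future in \<open>simp_all add: less_imp_le\<close>)
  thus "\<langle>simplex_vertex k, x\<rangle> \<le> 0"
    unfolding lor_commute[of "simplex_vertex k" x] by (rule lor_simplex_cone_nonpos[OF x])
qed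

section \<open>The chamber of the finite group\<close>

lemma SigmaG_Gamma: "g \<in> SigmaG n \<Longrightarrow> g \<in> Gamma n"
  using SigmaG_subset_stabilizer[OF dim_ge] Gamma_stabilizerD(1) by blast

lemma ex_SigmaG_chamber:
  "\<exists>g\<in>SigmaG n. g *v x \<in> polar_cone simple_roots"
proof (rule ex_translate_in_polar_cone[OF SigmaG_group[OF dim_ge] _ _ _
      rho_open_chamber[OF dim_ge]])
  fix w assume w: "w \<in> simple_roots"
  show "hrefl n w \<in> SigmaG n" using w
    by (auto simp: SigmaG_def Sigma_gens_eq[OF dim_ge] intro: gen_gen)
  show "is_vec n w" "0 < \<langle>w, w\<rangle>" using simple_rootD[OF dim_ge w] by simp_all
next
  have "finite ((\<lambda>A. A *v rho) ` Gamma_stabilizer kappa)"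
    using kappa_timelike is_vec_kappa int_vec_rho by (rule finite_stabilizer_orbit)
  thus "finite ((\<lambda>A. A *v rho) ` {A \<in> SigmaG n. \<langle>x, rho\<rangle> \<le> \<langle>x, A *v rho\<rangle>})"
    by (rule finite_subset[rotated]) (use SigmaG_subset_stabilizer[OF dim_ge] in blast)
qed

lemma nef_chamber_subset_simplex_cone: "nef \<inter> polar_cone simple_roots \<subseteq> simplex_cone"
proof
  fix x assume x: "x \<in> nef \<inter> polar_cone simple_roots"
  have "x (i+1) \<le> x i" if i: "i \<in> {1..<n}" for i
  proof -
    have "\<langle>x, swap_root i\<rangle> \<le> 0" using x i by (auto simp: polar_cone_def simple_roots_def)
    thus ?thesis using i by (simp add: lor_swap_root)
  qed
  moreover have "0 \<le> x n"
    using x neg_unit_vec_exceptional[of n] dim_ge lor_space_unit_vec[of n x]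
    by (auto simp: polar_cone_def)
  moreover have "0 \<le> height x"
  proof (cases "n = 2")
    case True
    have "\<langle>x, pair_vec\<rangle> \<le> 0" using x pair_vec_exceptional[OF dim_ge] by (simp add: polar_cone_def)
    hence "x 1 + x 2 \<le> x (n+1)" by (simp add: lor_pair_vec dim_ge)
    thus ?thesis using True unfolding height_def by (simp add: numeral_2_eq_2)
  next
    case False
    hence n: "3 \<le> n" using dim_ge by simp
    have "\<langle>x, triple_root\<rangle> \<le> 0" using x False by (simp add: polar_cone_def simple_roots_def)
    moreover have "(\<Sum>i=1..3. x i) = x 1 + x 2 + x 3" by (simp add: numeral_3_eq_3 numeral_2_eq_2)
    ultimately show ?thesis using n by (simp add: height_def lor_triple_root min_absorb2)
  qed
  ultimately show "x \<in> simplex_cone" using x by (simp add: simplex_cone_def polar_cone_def)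
qed

lemma ex_SigmaG_simplex_cone:
  assumes "x \<in> nef" shows "\<exists>g\<in>SigmaG n. g *v x \<in> simplex_cone"
  using ex_SigmaG_chamber[of x] nef_chamber_subset_simplex_cone
    nef_stabilizer[OF subsetD[OF SigmaG_subset_stabilizer[OF dim_ge]] assms] by blast

lemma nef_nonspacelike:
  assumes "x \<in> nef" shows "\<langle>x, x\<rangle> \<le> 0"
proof -
  obtain g where g: "g \<in> SigmaG n" "g *v x \<in> simplex_cone"
    using ex_SigmaG_simplex_cone[OF assms] by blast
  have "\<langle>g *v x, g *v x\<rangle> = \<langle>x, x\<rangle>"
    using SigmaG_Gamma[OF g(1)] assms by (simp add: lorentzian_lor polar_cone_def)
  thus ?thesis using simplex_cone_nonspacelike[OF g(2)] by simp
qed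

lemma Pn_eq: "Pn n = hyp n \<inter> nef"
proof (intro equalityI subsetI)
  fix x assume "x \<in> Pn n"
  then obtain g y where g: "g \<in> SigmaG n" "y \<in> Delta n" "x = g *v y"
    by (auto simp: Pn_def act_def)
  have "y \<in> hyp n" "y \<in> nef" using g(2) simplex_cone_subset_nef by (auto simp: Delta_eq dim_ge)
  thus "x \<in> hyp n \<inter> nef"
    unfolding g(3) using SigmaG_subset_stabilizer[OF dim_ge] g(1) SigmaG_Gamma[OF g(1)]
    by (auto intro: nef_stabilizer Gamma_hyp)
next
  fix x assume x: "x \<in> hyp n \<inter> nef"
  then obtain g where g: "g \<in> SigmaG n" "g *v x \<in> simplex_cone"
    using ex_SigmaG_simplex_cone by blast
  have G: "g \<in> Gamma n" using g(1) by (rule SigmaG_Gamma)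
  have "g *v x \<in> Delta n" using g(2) Gamma_hyp[OF G] x by (simp add: Delta_eq dim_ge)
  moreover have "x = adj g *v g *v x" using G x by (simp add: hyp_def)
  moreover have "adj g \<in> SigmaG n" using lorentzian_groupD(3)[OF SigmaG_group[OF dim_ge] g(1)] .
  ultimately show "x \<in> Pn n" unfolding Pn_def act_def by blast
qed

section \<open>The action of the congruence subgroup\<close>

lemma int_unit_meets_exceptional:
  assumes "int_unit r" shows "\<exists>e\<in>exceptional. \<langle>r, e\<rangle> > 0"
proof -
  have "r \<notin> nef" using nef_nonspacelike[of r] int_unitD(3)[OF assms] by auto
  thus ?thesis using int_unitD(2)[OF assms] by (auto simp: polar_cone_def not_le)
qed

text \<open>The mirrors of integral unit vectors do not cross the nef cone: reflecting \<open>r\<close> in an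
  exceptional vector that it meets positively lowers its degree \<open>- \<langle>r, kappa\<rangle>\<close>.\<close>
lemma lor_int_unit_nef_nonpos:
  assumes z: "z \<in> nef" and "int_unit r" "\<langle>r, kappa\<rangle> < 0"
  shows "\<langle>r, z\<rangle> \<le> 0"
  using assms(2,3)
proof (induction "nat \<lfloor>- \<langle>r, kappa\<rangle>\<rfloor>" arbitrary: r rule: less_induct)
  case less
  note r = less.prems
  have "\<langle>r, kappa\<rangle> = -1 \<or> \<langle>r, kappa\<rangle> \<le> -3"
    using int_unit_kappa_odd[OF r(1)] r(2) by (rule rcong_1_negative_cases)
  thus ?case
  proof
    assume "\<langle>r, kappa\<rangle> = -1"
    hence "r \<in> exceptional" using r(1) by (simp add: exceptional_def)
    thus ?thesis using polar_coneD[OF z] by (simp add: lor_commute[of r z])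
  next
    assume deg: "\<langle>r, kappa\<rangle> \<le> -3"
    obtain e where e: "e \<in> exceptional" "\<langle>r, e\<rangle> > 0"
      using int_unit_meets_exceptional[OF r(1)] by blast
    note E = exceptionalD[OF e(1)]
    have neg: "\<langle>reflect e r, kappa\<rangle> < 0"
      using lor_exceptional_less_half_degree[OF e(1) r(1) deg] E(4,5)
      by (simp add: lor_reflect_unit)
    have "\<langle>reflect e r, z\<rangle> \<le> 0"
      using exceptional_reflection_decreases_degree[OF e(1) int_unitD(1)[OF r(1)] e(2) neg]
        int_unit_reflect[OF E(1) r(1)] neg by (rule less.hyps)
    moreover have "\<langle>r, e\<rangle> * \<langle>e, z\<rangle> \<le> 0"
      using polar_coneD[OF z e(1)] e(2)
      by (intro mult_nonneg_nonpos) (auto simp: lor_commute[of e z])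
    ultimately show ?thesis using E(4) by (simp add: lor_reflect_unit)
  qed
qed

lemma lor_Gamma_exceptional_kappa_le:
  assumes A: "A \<in> Gamma n" and x: "x \<in> ample" "A *v x \<in> nef" and e: "e \<in> exceptional"
  shows "\<langle>A *v e, kappa\<rangle> \<le> -1"
proof -
  have r: "int_unit (A *v e)" using A exceptionalD(1)[OF e] by (rule int_unit_mat_vec)
  have "\<langle>A *v x, A *v e\<rangle> = \<langle>x, e\<rangle>"
    using A x(1) exceptionalD(3)[OF e] by (intro lorentzian_lor) (simp_all add: open_polar_cone_def)
  hence neg: "\<langle>A *v e, A *v x\<rangle> < 0"
    using open_polar_coneD[OF x(1) e] by (simp add: lor_commute)
  have "\<not> \<langle>A *v e, kappa\<rangle> > 0"
    using lor_int_unit_nef_nonpos[OF x(2) int_unit_minus[OF r]] neg by auto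
  hence "\<langle>A *v e, kappa\<rangle> < 0" using rcong_1_imp_neq_0[OF int_unit_kappa_odd[OF r]] by linarith
  thus ?thesis using rcong_1_negative_cases[OF int_unit_kappa_odd[OF r]] by linarith
qed

text \<open>\<open>A *v kappa - kappa\<close> is nef, so it pairs nonpositively with the integral unit vector
  \<open>A *v e\<close>.\<close>
lemma Gamma_ample_imp_permutes_exceptional:
  assumes A: "A \<in> Gamma n" and x: "x \<in> ample" "A *v x \<in> ample" and e: "e \<in> exceptional"
  shows "A *v e \<in> exceptional"
proof -
  have adj: "adj A \<in> Gamma n" using lorentzian_groupD(3)[OF Gamma_group] A .
  have le: "\<langle>A *v e, kappa\<rangle> \<le> -1"
    using A x(1) subsetD[OF open_polar_cone_subset x(2)] e by (rule lor_Gamma_exceptional_kappa_le)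
  have r: "int_unit (A *v e)" using A exceptionalD(1)[OF e] by (rule int_unit_mat_vec)
  have "A *v kappa - kappa \<in> nef"
  proof -
    have "\<langle>A *v kappa - kappa, f\<rangle> \<le> 0" if f: "f \<in> exceptional" for f
    proof -
      have "adj A *v A *v x \<in> nef"
        using A x(1) open_polar_cone_subset by (auto simp: open_polar_cone_def)
      hence "\<langle>adj A *v f, kappa\<rangle> \<le> -1" using lor_Gamma_exceptional_kappa_le[OF adj x(2) _ f]
        by blast
      thus ?thesis
        using exceptionalD(6)[OF f]
        by (simp add: lor_mat_vec_left lor_commute[of kappa "adj A *v f"])
    qed
    thus ?thesis by (simp add: polar_cone_def)
  qed
  hence "\<langle>A *v e, A *v kappa - kappa\<rangle> \<le> 0" using r le by (intro lor_int_unit_nef_nonpos) auto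
  moreover have "\<langle>A *v e, A *v kappa\<rangle> = -1"
    using A exceptionalD(3,5)[OF e] by (simp add: lorentzian_lor)
  ultimately show ?thesis using le r by (simp add: exceptional_def)
qed

lemma Gamma2_ample_imp_idm:
  assumes A: "A \<in> Gamma2 n" and x: "x \<in> ample" "A *v x \<in> ample"
  shows "A = idm n"
proof (rule fixes_exceptional_imp_idm[OF dim_ge])
  fix e assume e: "e \<in> exceptional"
  have "A *v e \<in> exceptional" using Gamma2_Gamma[OF A] x e
    by (rule Gamma_ample_imp_permutes_exceptional)
  thus "A *v e = e"
    using e Gamma2_rcong[OF A exceptionalD(2)[OF e]] by (rule exceptional_rcong_imp_eq)
qed (use A in simp)

lemma Gamma2_translates_of_ample_disjoint:
  assumes gh: "g \<in> Gamma2 n" "h \<in> Gamma2 n" and xy: "x \<in> ample" "y \<in> ample" "g *v x = h *v y"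
  shows "g = h"
proof (rule adj_mult_eq_idm_imp_eq)
  note G = lorentzian_groupD[OF Gamma2_group]
  have "(adj h ** g) *v x = y" using xy gh by (simp add: open_polar_cone_def)
  thus "adj h ** g = idm n" using G(3,4) gh xy(1,2) by (intro Gamma2_ample_imp_idm) auto
qed (use gh in simp_all)

lemma Gamma2_kappa_nef_imp_idm:
  assumes A: "A \<in> Gamma2 n" and nef: "A *v kappa \<in> nef"
  shows "A = idm n"
proof (rule Gamma2_ample_imp_idm[OF A kappa_ample])
  have adj: "adj A \<in> Gamma n" using lorentzian_groupD(3)[OF Gamma_group] A by simp
  have "\<langle>A *v kappa, e\<rangle> \<noteq> 0" if e: "e \<in> exceptional" for e
    using int_unit_kappa_odd[OF int_unit_mat_vec[OF adj exceptionalD(1)[OF e]]]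
      rcong_1_imp_neq_0[of "\<langle>adj A *v e, kappa\<rangle>"]
    by (simp add: lor_mat_vec_left lor_commute[of kappa])
  thus "A *v kappa \<in> ample" using nef by (force simp: polar_cone_def open_polar_cone_def)
qed

lemma lor_timelike_Gamma_kappa_neg:
  assumes v: "\<langle>v, v\<rangle> < 0" "v (n+1) > 0" and A: "A \<in> Gamma n"
  shows "\<langle>A *v kappa, v\<rangle> < 0"
proof -
  have "\<langle>A *v kappa, A *v kappa\<rangle> \<le> 0" using A kappa_timelike by (simp add: lorentzian_lor)
  moreover have "(A *v kappa) (n+1) > 0"
    using Gamma_positive_lorentzian[OF A] is_vec_kappa kappa_timelike kappa_future
    by (rule positive_lorentzian_future)
  ultimately show ?thesis using timelike_causal_sign_iff[OF v] by blast
qed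

lemma Gamma2_induct [consumes 1, case_names idm reflect]:
  assumes "A \<in> Gamma2 n" and idm: "P (idm n)"
    and reflect: "\<And>A e. A \<in> Gamma2 n \<Longrightarrow> e \<in> exceptional \<Longrightarrow> \<langle>A *v kappa, e\<rangle> < 0 \<Longrightarrow> P A
      \<Longrightarrow> P (hrefl n e ** A)"
  shows "P A"
  using assms(1)
proof (induction "nat \<lfloor>- \<langle>A *v kappa, kappa\<rangle>\<rfloor>" arbitrary: A rule: less_induct)
  case less
  note A = less.prems
  show ?case
  proof (cases "A *v kappa \<in> nef")
    case True
    thus ?thesis using Gamma2_kappa_nef_imp_idm[OF A] idm by simp
  next
    case False
    then obtain e where e: "e \<in> exceptional" "\<langle>A *v kappa, e\<rangle> > 0"
      by (auto simp: polar_cone_def not_le)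
    note E = exceptionalD[OF e(1)]
    let ?B = "hrefl n e ** A"
    have B: "?B \<in> Gamma2 n"
      using lorentzian_groupD(4)[OF Gamma2_group Gamma2_hrefl[OF E(2,4)] A] .
    have Bk: "?B *v kappa = reflect e (A *v kappa)" using E by (simp add: mat_vec_hrefl)
    have "nat \<lfloor>- \<langle>?B *v kappa, kappa\<rangle>\<rfloor> < nat \<lfloor>- \<langle>A *v kappa, kappa\<rangle>\<rfloor>"
      using lor_timelike_Gamma_kappa_neg[OF kappa_timelike kappa_future Gamma2_Gamma[OF B]] A e
      unfolding Bk
      by (intro exceptional_reflection_decreases_degree) auto
    hence "P ?B" using B by (rule less.hyps)
    moreover have "\<langle>?B *v kappa, e\<rangle> < 0" unfolding Bk using e(2) E(4)
      by (simp add: lor_reflect_unit)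
    ultimately have "P (hrefl n e ** ?B)" using reflect[OF B e(1)] by blast
    moreover have "hrefl n e ** ?B = A"
      using E A Gamma_lorentzian[OF Gamma2_Gamma[OF A]]
      by (intro mat_eqI) (auto simp: lorentzian_is_mat mat_vec_hrefl reflect_reflect)
    ultimately show ?thesis by simp
  qed
qed

lemma Gamma2_eq_gen_grp: "Gamma2 n = gen_grp n (hrefl n ` exceptional)"
proof
  show "Gamma2 n \<subseteq> gen_grp n (hrefl n ` exceptional)"
  proof
    fix A assume "A \<in> Gamma2 n"
    thus "A \<in> gen_grp n (hrefl n ` exceptional)"
      by (induction rule: Gamma2_induct) (auto intro: gen_id gen_gen gen_mult)
  qed
  show "gen_grp n (hrefl n ` exceptional) \<subseteq> Gamma2 n"
    using Gamma2_hrefl exceptionalD(2,4) by (intro gen_grp_subset[OF Gamma2_group]) blast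
qed

lemma lor_nef_Gamma2_kappa_le:
  assumes A: "A \<in> Gamma2 n" and p: "p \<in> nef"
  shows "\<langle>A *v kappa, p\<rangle> \<le> \<langle>kappa, p\<rangle>"
  using A
proof (induction rule: Gamma2_induct)
  case (reflect A e)
  note E = exceptionalD[OF reflect(2)]
  have "0 \<le> \<langle>A *v kappa, e\<rangle> * \<langle>e, p\<rangle>"
    using reflect(3) polar_coneD[OF p reflect(2)]
    by (intro mult_nonpos_nonpos) (auto simp: lor_commute[of e p])
  thus ?case using reflect.IH E by (simp add: mat_vec_hrefl lor_reflect_unit)
qed simp

lemma finite_Gamma2_kappa_bounded:
  assumes "\<langle>v, v\<rangle> < 0" shows "finite {A \<in> Gamma2 n. \<bar>\<langle>A *v kappa, v\<rangle>\<bar> \<le> C}" (is "finite ?S")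
proof (rule finite_imageD)
  have "(\<lambda>A. A *v kappa) ` ?S \<subseteq> {u. int_vec u \<and> \<langle>u, u\<rangle> \<le> real n - 9 \<and> \<bar>\<langle>u, v\<rangle>\<bar> \<le> C}"
    by (auto simp: lorentzian_lor)
  thus "finite ((\<lambda>A. A *v kappa) ` ?S)"
    using finite_bounded_int_vecs[OF assms] by (rule finite_subset)
  show "inj_on (\<lambda>A. A *v kappa) ?S"
    using kappa_ample by (auto intro!: inj_onI Gamma2_translates_of_ample_disjoint)
qed

lemma ex_Gamma2_translate_nef:
  assumes x: "x \<in> hyp n" shows "\<exists>A\<in>Gamma2 n. A *v x \<in> nef"
proof (rule ex_translate_in_polar_cone[OF Gamma2_group _ _ _ kappa_ample])
  fix e assume "e \<in> exceptional"
  note E = exceptionalD[OF this]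
  show "hrefl n e \<in> Gamma2 n" using E(2,4) by (rule Gamma2_hrefl)
  show "is_vec n e" "0 < \<langle>e, e\<rangle>" using E by simp_all
next
  have "\<bar>\<langle>A *v kappa, x\<rangle>\<bar> \<le> \<bar>\<langle>kappa, x\<rangle>\<bar>" if "A \<in> Gamma2 n" "\<langle>x, kappa\<rangle> \<le> \<langle>x, A *v kappa\<rangle>" for A
    using lor_timelike_Gamma_kappa_neg[OF hyp_timelike[OF x] hypD(3)[OF x] Gamma2_Gamma[OF that(1)]]
      that(2)
    by (simp add: lor_commute[of x kappa] lor_commute[of x "A *v kappa"])
  hence "{A \<in> Gamma2 n. \<langle>x, kappa\<rangle> \<le> \<langle>x, A *v kappa\<rangle>}
      \<subseteq> {A \<in> Gamma2 n. \<bar>\<langle>A *v kappa, x\<rangle>\<bar> \<le> \<bar>\<langle>kappa, x\<rangle>\<bar>}" by blast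
  thus "finite ((\<lambda>A. A *v kappa) ` {A \<in> Gamma2 n. \<langle>x, kappa\<rangle> \<le> \<langle>x, A *v kappa\<rangle>})"
    using finite_Gamma2_kappa_bounded[OF hyp_timelike[OF x]]
    by (intro finite_imageI) (rule finite_subset)
qed

lemma near_translate_kappa_bound:
  assumes x: "x \<in> hyp n" and A: "A \<in> Gamma2 n" and p: "p \<in> hyp n" "p \<in> nef"
    and near: "- \<langle>x, A *v p\<rangle> < 2"
  shows "\<bar>\<langle>A *v kappa, x\<rangle>\<bar> \<le> 16 * \<bar>\<langle>kappa, x\<rangle>\<bar>"
proof -
  define u y where "u = A *v kappa" and "y = A *v p"
  have G: "A \<in> Gamma n" using A by simp
  have y: "y \<in> hyp n" unfolding y_def using G p(1) by (rule Gamma_hyp)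
  have xy: "\<bar>\<langle>x, y\<rangle>\<bar> \<le> 2" using near hyp_minus_lor_ge_1[OF x y] by (simp add: y_def)
  have u: "is_vec n u" "\<langle>u, u\<rangle> \<le> 0" using G kappa_timelike by (simp_all add: u_def lorentzian_lor)
  have "\<langle>adj A *v kappa, p\<rangle> \<le> \<langle>kappa, p\<rangle>"
    using lor_nef_Gamma2_kappa_le[OF lorentzian_groupD(3)[OF Gamma2_group A] p(2)] .
  moreover have "\<langle>u, y\<rangle> = \<langle>kappa, p\<rangle>"
    using G hypD(1)[OF p(1)] by (simp add: u_def y_def lorentzian_lor)
  moreover have "\<langle>kappa, y\<rangle> = \<langle>adj A *v kappa, p\<rangle>" by (simp add: y_def lor_mat_vec_right)
  moreover have "\<langle>u, y\<rangle> < 0" unfolding u_def using hyp_timelike[OF y] hypD(3)[OF y] G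
    by (rule lor_timelike_Gamma_kappa_neg)
  ultimately have uy: "\<bar>\<langle>u, y\<rangle>\<bar> \<le> \<bar>\<langle>kappa, y\<rangle>\<bar>" by linarith
  have "\<bar>\<langle>kappa, y\<rangle>\<bar> \<le> 2 * \<bar>\<langle>kappa, x\<rangle>\<bar> * \<bar>\<langle>y, x\<rangle>\<bar>"
    using hypD[OF y] kappa_timelike by (intro nonspacelike_lor_le[OF x]) auto
  also have "\<dots> \<le> 2 * \<bar>\<langle>kappa, x\<rangle>\<bar> * 2"
    using xy by (intro mult_left_mono) (auto simp: lor_commute[of y x])
  finally have ky: "\<bar>\<langle>kappa, y\<rangle>\<bar> \<le> 4 * \<bar>\<langle>kappa, x\<rangle>\<bar>" by simp
  have "\<bar>\<langle>u, x\<rangle>\<bar> \<le> 2 * \<bar>\<langle>u, y\<rangle>\<bar> * \<bar>\<langle>x, y\<rangle>\<bar>"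
    using u hypD[OF x] by (intro nonspacelike_lor_le[OF y]) auto
  also have "\<dots> \<le> 2 * (4 * \<bar>\<langle>kappa, x\<rangle>\<bar>) * 2"
    using xy uy ky by (intro mult_mono) auto
  finally show ?thesis by (simp add: u_def)
qed

section \<open>The right-angled polytope\<close>

lemma h_int_nef: "h_int n (hyp n) (hyp n \<inter> nef) = hyp n \<inter> ample"
  by (rule h_int_polar_cone) (simp_all add: finite_exceptional exceptionalD)

lemma h_closure_ample: "h_closure n (hyp n \<inter> ample) = hyp n \<inter> nef"
  by (rule h_closure_open_polar_cone[OF _ kappa_ample]) (rule exceptionalD(3))

lemma hyp_ample_nonempty: "hyp n \<inter> ample \<noteq> {}"
proof -
  obtain r where r: "r > 0" "r *\<^sub>R kappa \<in> hyp n"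
    using is_vec_kappa kappa_timelike kappa_future by (rule timelike_future_scales_into_hyp)
  hence "r *\<^sub>R kappa \<in> ample" by (simp add: open_polar_cone_def exceptionalD)
  thus ?thesis using r by blast
qed

text \<open>The projection of \<open>kappa\<close> to the wall of \<open>e\<close> lies strictly inside all other walls.\<close>
lemma ex_exceptional_wall_point:
  assumes e: "e \<in> exceptional"
  shows "\<exists>x\<in>hyp n. \<langle>x, e\<rangle> = 0 \<and> x \<in> open_polar_cone (exceptional - {e})"
proof -
  note E = exceptionalD[OF e]
  define z where "z = kappa + e"
  have z: "is_vec n z" "\<langle>z, z\<rangle> < 0" "\<langle>z, e\<rangle> = 0" "\<langle>z, kappa\<rangle> < 0"
    using E dim_le by (simp_all add: z_def)
  have "z (n+1) > 0"
    using timelike_causal_sign_iff[OF kappa_timelike kappa_future, of z] z(2,4) by simp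
  then obtain r where r: "r > 0" "r *\<^sub>R z \<in> hyp n"
    using z(1,2) by (elim timelike_future_scales_into_hyp)
  have "\<langle>z, f\<rangle> < 0" if f: "f \<in> exceptional - {e}" for f
    using lor_exceptional_less_1[OF e, of f] f exceptionalD(6)[of f] by (auto simp: z_def)
  hence "r *\<^sub>R z \<in> open_polar_cone (exceptional - {e})"
    using z(1) r(1) by (simp add: open_polar_cone_def mult_pos_neg)
  thus ?thesis using r(2) z(3) by (intro bexI[of _ "r *\<^sub>R z"]) simp_all
qed

lemma side_normals_nef: "side_normals n (hyp n \<inter> nef) = exceptional"
  by (rule side_normals_polar_cone[OF finite_exceptional _ _ hyp_ample_nonempty
        ex_exceptional_wall_point])
    (simp_all add: exceptionalD)

definition vertices :: "(nat \<Rightarrow> real) set" where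
  "vertices = (\<Union>k\<in>{0..n}. (\<lambda>A. A *v simplex_vertex k) ` Gamma_stabilizer kappa)"

lemma finite_vertices: "finite vertices"
  unfolding vertices_def using kappa_timelike is_vec_kappa int_vec_simplex_vertex
  by (intro finite_UN_I finite_stabilizer_orbit) auto

lemma verticesD:
  assumes "v \<in> vertices"
  shows "v \<in> nef" "is_vec n v" "\<langle>v, v\<rangle> \<le> 0" "v (n+1) > 0"
proof -
  obtain A k where A: "A \<in> Gamma_stabilizer kappa" and k: "k \<le> n" and v: "v = A *v simplex_vertex k"
    using assms by (auto simp: vertices_def)
  have s: "is_vec n (simplex_vertex k)" using int_vec_simplex_vertex[OF k] by simp
  show "v \<in> nef" unfolding v using A simplex_vertex_nef[OF k] by (rule nef_stabilizer)
  thus "is_vec n v" by (simp add: polar_cone_def)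
  show causal: "\<langle>v, v\<rangle> \<le> 0"
    using Gamma_stabilizerD(1)[OF A] s simplex_vertex_nonspacelike[OF k]
    by (simp add: v lorentzian_lor)
  note sign = timelike_causal_sign_iff[OF kappa_timelike kappa_future]
  have "\<langle>v, kappa\<rangle> = \<langle>simplex_vertex k, kappa\<rangle>"
    unfolding v using A is_vec_kappa s by (rule lor_stabilizer)
  also have "\<dots> < 0" using sign simplex_vertex_nonspacelike[OF k] simplex_vertex_future[OF k]
    by blast
  finally show "v (n+1) > 0" using sign causal by blast
qed

lemma nef_imp_vertex_combination:
  assumes x: "x \<in> nef"
  shows "\<exists>c. (\<forall>v\<in>vertices. 0 \<le> c v) \<and> x = (\<Sum>v\<in>vertices. c v *\<^sub>R v)"
proof -
  obtain g where g: "g \<in> SigmaG n" "g *v x \<in> simplex_cone"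
    using ex_SigmaG_simplex_cone[OF x] by blast
  have "adj g \<in> Gamma_stabilizer kappa"
    using lorentzian_groupD(3)[OF SigmaG_group[OF dim_ge] g(1)] SigmaG_subset_stabilizer[OF dim_ge]
    by blast
  hence w: "(\<lambda>k. adj g *v simplex_vertex k) ` {0..n} \<subseteq> vertices" by (auto simp: vertices_def)
  define a where "a = simplex_coeff (g *v x)"
  have a: "0 \<le> a k" if "k \<in> {0..n}" for k using simplex_coeff_nonneg[OF g(2)] that
    by (simp add: a_def)
  have "x = adj g *v g *v x" using SigmaG_Gamma[OF g(1)] x by (simp add: polar_cone_def)
  also have "g *v x = (\<Sum>k=0..n. a k *\<^sub>R simplex_vertex k)"
    unfolding a_def by (rule simplex_decomposition) simp
  finally have "x = (\<Sum>k=0..n. a k *\<^sub>R (adj g *v simplex_vertex k))" by (simp add: mat_vec_sum)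
  thus ?thesis using conic_combination_regroup[OF finite_vertices w finite_atLeastAtMost a] by simp
qed

lemma vertex_combination_nef:
  assumes "is_vec n x" and c: "\<And>v. v \<in> vertices \<Longrightarrow> 0 \<le> c v" "x = (\<Sum>v\<in>vertices. c v *\<^sub>R v)"
  shows "x \<in> nef"
proof -
  have "\<langle>x, e\<rangle> \<le> 0" if e: "e \<in> exceptional" for e
    unfolding c(2) lor_sum_left using c(1) polar_coneD[OF verticesD(1) e]
    by (intro sum_nonpos) (simp add: mult_nonneg_nonpos)
  thus ?thesis using assms(1) by (simp add: polar_cone_def)
qed

lemma polytope_nef: "polytope n (hyp n \<inter> nef)"
  unfolding polytope_def
proof (intro conjI exI[of _ vertices])
  show "vertices \<subseteq> {v. is_vec n v \<and> lor n v v \<le> 0 \<and> v (n+1) > 0}" using verticesD by blast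
  have sum: "(\<lambda>i. \<Sum>v\<in>vertices. c v * v i) = (\<Sum>v\<in>vertices. c v *\<^sub>R v)" for c
    by (simp add: fun_eq_iff sum_fun_apply)
  show "hyp n \<inter> nef = {x \<in> hyp n. \<exists>c. (\<forall>v\<in>vertices. 0 \<le> c v) \<and> x = (\<lambda>i. \<Sum>v\<in>vertices. c v * v i)}"
    unfolding sum
  proof (intro equalityI subsetI)
    fix x assume "x \<in> {x \<in> hyp n. \<exists>c. (\<forall>v\<in>vertices. 0 \<le> c v) \<and> x = (\<Sum>v\<in>vertices. c v *\<^sub>R v)}"
    thus "x \<in> hyp n \<inter> nef" using vertex_combination_nef[OF hypD(1)] by blast
  qed (use nef_imp_vertex_combination in blast)
  show "h_int n (hyp n) (hyp n \<inter> nef) \<noteq> {}" unfolding h_int_nef by (rule hyp_ample_nonempty)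
qed (rule finite_vertices)

lemma adjacent_exceptional_orthogonal:
  assumes e: "e \<in> exceptional" and f: "f \<in> exceptional" and adj: "adjacent_sides n P e f"
  shows "\<langle>e, f\<rangle> = 0"
proof -
  obtain x where x: "e \<noteq> f" "x \<in> hyp n" "\<langle>x, e\<rangle> = 0" "\<langle>x, f\<rangle> = 0"
    using adj unfolding adjacent_sides_def h_int_def by blast
  note E = exceptionalD[OF e] and F = exceptionalD[OF f]
  have "e \<noteq> - f" using E(5) F(5) by auto
  hence "\<bar>\<langle>e, f\<rangle>\<bar> < 1"
    using meeting_walls_lor_less_1[OF hyp_timelike[OF x(2)], of e f] x E F
    by (simp add: lor_commute[of e x] lor_commute[of f x])
  moreover have "\<langle>e, f\<rangle> \<in> \<int>" using E(2) F(2) by (rule lor_Ints)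
  ultimately show ?thesis using Ints_nonzero_abs_less1 by blast
qed

lemma right_angled_polytope_nef: "right_angled_polytope n (hyp n \<inter> nef)"
  unfolding right_angled_polytope_def side_normals_nef
  using polytope_nef adjacent_exceptional_orthogonal by auto

lemma hyp_eq_UN_Gamma2_nef: "hyp n = (\<Union>g\<in>Gamma2 n. act n g (hyp n \<inter> nef))"
proof (intro equalityI subsetI)
  fix x assume x: "x \<in> hyp n"
  then obtain A where A: "A \<in> Gamma2 n" "A *v x \<in> nef" using ex_Gamma2_translate_nef by blast
  hence "A *v x \<in> hyp n \<inter> nef" using Gamma_hyp[OF Gamma2_Gamma x] by blast
  moreover have "x = adj A *v A *v x" using A(1) hypD(1)[OF x] by simp
  ultimately show "x \<in> (\<Union>g\<in>Gamma2 n. act n g (hyp n \<inter> nef))"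
    using lorentzian_groupD(3)[OF Gamma2_group A(1)] unfolding act_def by blast
next
  fix x assume "x \<in> (\<Union>g\<in>Gamma2 n. act n g (hyp n \<inter> nef))"
  thus "x \<in> hyp n" using Gamma_hyp Gamma2_Gamma unfolding act_def by blast
qed

lemma Gamma2_translates_locally_finite:
  assumes x: "x \<in> hyp n"
  shows "finite {g \<in> Gamma2 n. \<exists>y\<in>act n g (hyp n \<inter> nef). - lor n x y < 2}"
proof (rule finite_subset)
  show "{g \<in> Gamma2 n. \<exists>y\<in>act n g (hyp n \<inter> nef). - lor n x y < 2}
      \<subseteq> {g \<in> Gamma2 n. \<bar>\<langle>g *v kappa, x\<rangle>\<bar> \<le> 16 * \<bar>\<langle>kappa, x\<rangle>\<bar>}"
    using near_translate_kappa_bound[OF x] unfolding act_def by blast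
qed (rule finite_Gamma2_kappa_bounded[OF hyp_timelike[OF x]])

lemma fundamental_polytope_nef: "fundamental_polytope n (Gamma2 n) (hyp n \<inter> nef)"
  unfolding fundamental_polytope_def h_int_nef h_closure_ample
proof (intro conjI ballI impI)
  show "polytope n (hyp n \<inter> nef)" by (rule polytope_nef)
  show "act n g (hyp n \<inter> ample) \<inter> act n h (hyp n \<inter> ample) = {}"
    if "g \<in> Gamma2 n" "h \<in> Gamma2 n" "g \<noteq> h" for g h
    using that Gamma2_translates_of_ample_disjoint[of g h] unfolding act_def by blast
  show "hyp n = (\<Union>g\<in>Gamma2 n. act n g (hyp n \<inter> nef))" by (rule hyp_eq_UN_Gamma2_nef)
  show "\<exists>\<epsilon>>0. finite {g \<in> Gamma2 n. \<exists>y\<in>act n g (hyp n \<inter> nef). - lor n x y < 1 + \<epsilon>}"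
    if "x \<in> hyp n" for x
    using Gamma2_translates_locally_finite[OF that] by (intro exI[of _ 1]) simp
qed

lemma Gamma2_eq_side_reflection_group:
  "Gamma2 n = gen_grp n (side_reflections n (hyp n \<inter> nef))"
  unfolding side_reflections_def side_normals_nef by (rule Gamma2_eq_gen_grp)

end

theorem theorem2p1:
  fixes n :: nat
  assumes "2 \<le> n" and "n \<le> 7"
  shows "right_angled_polytope n (Pn n)
       \<and> fundamental_polytope n (Gamma2 n) (Pn n)
       \<and> Gamma2 n = gen_grp n (side_reflections n (Pn n))"
proof -
  interpret congruence_two n using assms by unfold_locales
  show ?thesis
    unfolding Pn_eq
    using right_angled_polytope_nef fundamental_polytope_nef Gamma2_eq_side_reflection_group
    by blast
qed

end
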